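(* Let $d>1$ be an integer, let $\mathcal{C}$ be a $d$-Calabi-Yau triangulated category and let $\mathcal{T}$ be a $d$-cluster tilting subcategory of $\mathcal{C}$. Then $\mathcal{C}$ is a direct sum of indecomposable triangulated subcategories $\mathcal{C}_i$, $i\in I$, if and only if $\mathcal{T}$ is a direct sum of indecomposable subcategories $\mathcal{T}_i$, $i\in I$. Moreover (for these corresponding decompositions, indexed by the same set $I$) one has $\mathcal{C}_i=\mathcal{T}_i*\mathcal{T}_i[1]*\cdots*\mathcal{T}_i[d-1]$, and $\mathcal{T}_i$ is a $d$-cluster tilting subcategory of $\mathcal{C}_i$, for every $i\in I$.
   Context: Fix a field $k$. All triangulated categories are $k$-linear, Hom-finite and Krull-Schmidt, with shift functor $[1]$; $\mathrm{Ext}^n(X,Y)=\mathrm{Hom}(X,Y[n])$. A subcategory means a full subcategory closed under isomorphisms, finite direct sums and direct summands. A triangulated subcategory is a subcategory closed under $[1]$, $[-1]$ and extensions. For subcategories $\mathcal{X},\mathcal{Y}$, $\mathrm{Hom}(\mathcal{X},\mathcal{Y})=0$ means $\mathrm{Hom}(X,Y)=0$ for all $X\in\mathcal{X}$, $Y\in\mathcal{Y}$ (similarly for $\mathrm{Ext}$), and $\mathcal{X}*\mathcal{Y}$ is the class of objects $Z$ admitting a triangle $X\to Z\to Y\to X[1]$ with $X\in\mathcal{X}$, $Y\in\mathcal{Y}$. $\mathcal{C}$ is $d$-Calabi-Yau if $[d]$ is a Serre functor: $\mathrm{Hom}(X,Y)\cong \mathrm{Hom}_k(\mathrm{Hom}(Y,X[d]),k)$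 functorially in $X,Y$. A subcategory $\mathcal{T}$ of $\mathcal{C}$ is $d$-cluster tilting if $\mathrm{Ext}^i(\mathcal{T},\mathcal{T})=0$ for $1\le i\le d-1$, $\mathcal{T}$ is functorially finite in $\mathcal{C}$, and for $T\in\mathcal{C}$: $T\in\mathcal{T}$ iff $\mathrm{Ext}^i(\mathcal{T},T)=0$ for all $1\le i\le d-1$ iff $\mathrm{Ext}^i(T,\mathcal{T})=0$ for all $1\le i\le d-1$. $\mathcal{C}=\oplus_{i\in I}\mathcal{C}_i$ (direct sum of triangulated subcategories) means: every object of $\mathcal{C}$ is a direct sum of finitely many objects $M_i\in\mathcal{C}_i$, and $\mathrm{Hom}(\mathcal{C}_i,\mathcal{C}_j)=0$ for $i\ne j$. $\mathcal{C}$ is indecomposable if it is not a direct sum of two nonzero triangulated subcategories. For a $d$-cluster tilting subcategory $\mathcal{T}$, $\mathcal{T}=\oplus_{i\in I}\mathcal{T}_i$ (direct sum of subcategories $\mathcal{T}_i\subseteq\mathcal{T}$) means: (1) every object of $\mathcal{T}$ is a direct sum of finitely many objects $T_i\in\mathcal{T}_i$; (2) $\mathrm{Hom}(\mathcal{T}_i,\mathcal{T}_j)=0$ for $i\neq j$; (3) $\mathrm{Hom}(\mathcal{T}_i[t],\mathcal{T}_j)=0$ for $i\ne j$ and $1\le t\le d-2$ (empty for $d=2$). A subcategory is indecomposable if it is not a direct sum, in the sense of (1)-(3), of two nonzero subcategories. *)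

theory Defs
  imports Complex_Main
begin

(* All Hom spaces are subspaces of one ambient k-vector space 'm, and composition and the
   shift on morphisms are not indexed by objects.  This is no restriction: for an arbitrary
   k-linear category with shift take 'm to be the direct sum of all Hom(X,Y), with composition
   extended bilinearly (by 0 on non-composable pairs) and the shift extended linearly.
   The objects are all elements of the type 'o; full subcategories are sets of objects. *)

record ('o, 'm, 'k) tri_cat =
  Hom :: "'o \<Rightarrow> 'o \<Rightarrow> 'm set"
  Idn :: "'o \<Rightarrow> 'm"
  Comp :: "'m \<Rightarrow> 'm \<Rightarrow> 'm" (infixl "\<cdot>\<index>" 70)
  Scale :: "'k \<Rightarrow> 'm \<Rightarrow> 'm"
  Shift :: "'o \<Rightarrow> 'o"
  Shift_map :: "'m \<Rightarrow> 'm"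
  Triangle :: "'o \<Rightarrow> 'o \<Rightarrow> 'o \<Rightarrow> 'm \<Rightarrow> 'm \<Rightarrow> 'm \<Rightarrow> bool"

section \<open>Linear and additive categories\<close>

locale linear_category =
  fixes C :: "('o, 'm::ab_group_add, 'k::field) tri_cat" (structure)
  assumes vector_space: "vector_space (Scale C)"
    and subspace_Hom: "module.subspace (Scale C) (Hom C X Y)"
    and Idn_in_Hom: "Idn C X \<in> Hom C X X"
    and Comp_in_Hom: "f \<in> Hom C X Y \<Longrightarrow> g \<in> Hom C Y Z \<Longrightarrow> g \<cdot> f \<in> Hom C X Z"
    and Comp_assoc: "f \<in> Hom C X Y \<Longrightarrow> g \<in> Hom C Y Z \<Longrightarrow> h \<in> Hom C Z W
      \<Longrightarrow> (h \<cdot> g) \<cdot> f = h \<cdot> (g \<cdot> f)"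
    and Comp_Idn: "f \<in> Hom C X Y \<Longrightarrow> f \<cdot> Idn C X = f"
    and Idn_Comp: "f \<in> Hom C X Y \<Longrightarrow> Idn C Y \<cdot> f = f"
    and Comp_add_right: "f \<in> Hom C X Y \<Longrightarrow> f' \<in> Hom C X Y \<Longrightarrow> g \<in> Hom C Y Z
      \<Longrightarrow> g \<cdot> (f + f') = g \<cdot> f + g \<cdot> f'"
    and Comp_add_left: "f \<in> Hom C X Y \<Longrightarrow> g \<in> Hom C Y Z \<Longrightarrow> g' \<in> Hom C Y Z
      \<Longrightarrow> (g + g') \<cdot> f = g \<cdot> f + g' \<cdot> f"
    and Comp_Scale_right: "f \<in> Hom C X Y \<Longrightarrow> g \<in> Hom C Y Z
      \<Longrightarrow> g \<cdot> Scale C r f = Scale C r (g \<cdot> f)"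
    and Comp_Scale_left: "f \<in> Hom C X Y \<Longrightarrow> g \<in> Hom C Y Z
      \<Longrightarrow> Scale C r g \<cdot> f = Scale C r (g \<cdot> f)"

definition is_iso :: "('o, 'm, 'k) tri_cat \<Rightarrow> 'o \<Rightarrow> 'o \<Rightarrow> 'm \<Rightarrow> bool" where
  "is_iso C X Y f \<longleftrightarrow> f \<in> Hom C X Y \<and>
     (\<exists>g \<in> Hom C Y X. g \<cdot>\<^bsub>C\<^esub> f = Idn C X \<and> f \<cdot>\<^bsub>C\<^esub> g = Idn C Y)"

definition isomorphic :: "('o, 'm, 'k) tri_cat \<Rightarrow> 'o \<Rightarrow> 'o \<Rightarrow> bool" where
  "isomorphic C X Y \<longleftrightarrow> (\<exists>f. is_iso C X Y f)"

definition zero_object :: "('o, 'm::zero, 'k) tri_cat \<Rightarrow> 'o \<Rightarrow> bool" where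
  "zero_object C Z \<longleftrightarrow> (\<forall>X. Hom C X Z = {0} \<and> Hom C Z X = {0})"

definition is_direct_sum ::
    "('o, 'm::ab_group_add, 'k) tri_cat \<Rightarrow> 'i set \<Rightarrow> ('i \<Rightarrow> 'o) \<Rightarrow> 'o \<Rightarrow> bool" where
  "is_direct_sum C J M X \<longleftrightarrow> finite J \<and>
     (\<exists>inj pr. (\<forall>i\<in>J. inj i \<in> Hom C (M i) X \<and> pr i \<in> Hom C X (M i)) \<and>
        (\<forall>i\<in>J. \<forall>j\<in>J. pr j \<cdot>\<^bsub>C\<^esub> inj i = (if i = j then Idn C (M i) else 0)) \<and>
        (\<Sum>i\<in>J. inj i \<cdot>\<^bsub>C\<^esub> pr i) = Idn C X)"

definition is_biproduct :: "('o, 'm::ab_group_add, 'k) tri_cat \<Rightarrow> 'o \<Rightarrow> 'o \<Rightarrow> 'o \<Rightarrow> bool" where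
  "is_biproduct C A B X \<longleftrightarrow> is_direct_sum C (UNIV :: bool set) (\<lambda>b. if b then A else B) X"

locale additive_category = linear_category C
  for C :: "('o, 'm::ab_group_add, 'k::field) tri_cat" (structure) +
  assumes ex_zero_object: "\<exists>Z. zero_object C Z"
    and ex_biproduct: "\<exists>X. is_biproduct C A B X"

definition hom_finite :: "('o, 'm::ab_group_add, 'k::field) tri_cat \<Rightarrow> bool" where
  "hom_finite C \<longleftrightarrow> (\<forall>X Y. \<exists>B. finite B \<and> module.span (Scale C) B = Hom C X Y)"

definition local_endomorphism_ring :: "('o, 'm::ab_group_add, 'k) tri_cat \<Rightarrow> 'o \<Rightarrow> bool" where
  "local_endomorphism_ring C X \<longleftrightarrow> Idn C X \<noteq> 0 \<and>
     (\<forall>f \<in> Hom C X X. \<forall>g \<in> Hom C X X.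
        \<not> is_iso C X X f \<longrightarrow> \<not> is_iso C X X g \<longrightarrow> \<not> is_iso C X X (f + g))"

definition krull_schmidt :: "('o, 'm::ab_group_add, 'k) tri_cat \<Rightarrow> bool" where
  "krull_schmidt C \<longleftrightarrow>
     (\<forall>X. \<exists>(n::nat) M. is_direct_sum C {..<n} M X \<and> (\<forall>i<n. local_endomorphism_ring C (M i)))"

section \<open>Triangulated categories\<close>

(* The shift is only required to be a k-linear autoequivalence, not a strict automorphism.
   TR4 below is the octahedral axiom. *)

locale triangulated_category = additive_category C
  for C :: "('o, 'm::ab_group_add, 'k::field) tri_cat" (structure) +
  assumes Shift_map_in_Hom: "f \<in> Hom C X Y \<Longrightarrow> Shift_map C f \<in> Hom C (Shift C X) (Shift C Y)"
    and Shift_map_Idn: "Shift_map C (Idn C X) = Idn C (Shift C X)"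
    and Shift_map_Comp: "f \<in> Hom C X Y \<Longrightarrow> g \<in> Hom C Y Z
      \<Longrightarrow> Shift_map C (g \<cdot> f) = Shift_map C g \<cdot> Shift_map C f"
    and Shift_map_add: "f \<in> Hom C X Y \<Longrightarrow> f' \<in> Hom C X Y
      \<Longrightarrow> Shift_map C (f + f') = Shift_map C f + Shift_map C f'"
    and Shift_map_Scale: "f \<in> Hom C X Y \<Longrightarrow> Shift_map C (Scale C r f) = Scale C r (Shift_map C f)"
    and Shift_fully_faithful: "bij_betw (Shift_map C) (Hom C X Y) (Hom C (Shift C X) (Shift C Y))"
    and Shift_ess_surj: "\<exists>X. isomorphic C (Shift C X) Y"
    and Triangle_in_Hom: "Triangle C X Y Z f g h
      \<Longrightarrow> f \<in> Hom C X Y \<and> g \<in> Hom C Y Z \<and> h \<in> Hom C Z (Shift C X)"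
    and TR1_iso: "Triangle C X Y Z f g h
      \<Longrightarrow> f' \<in> Hom C X' Y' \<Longrightarrow> g' \<in> Hom C Y' Z' \<Longrightarrow> h' \<in> Hom C Z' (Shift C X')
      \<Longrightarrow> is_iso C X X' a \<Longrightarrow> is_iso C Y Y' b \<Longrightarrow> is_iso C Z Z' c
      \<Longrightarrow> b \<cdot> f = f' \<cdot> a \<Longrightarrow> c \<cdot> g = g' \<cdot> b \<Longrightarrow> Shift_map C a \<cdot> h = h' \<cdot> c
      \<Longrightarrow> Triangle C X' Y' Z' f' g' h'"
    and TR1_Idn: "zero_object C Z \<Longrightarrow> Triangle C X X Z (Idn C X) 0 0"
    and TR1_cone: "f \<in> Hom C X Y \<Longrightarrow> \<exists>Z g h. Triangle C X Y Z f g h"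
    and TR2: "f \<in> Hom C X Y \<Longrightarrow> g \<in> Hom C Y Z \<Longrightarrow> h \<in> Hom C Z (Shift C X)
      \<Longrightarrow> Triangle C X Y Z f g h \<longleftrightarrow> Triangle C Y Z (Shift C X) g h (- Shift_map C f)"
    and TR3: "Triangle C X Y Z f g h \<Longrightarrow> Triangle C X' Y' Z' f' g' h'
      \<Longrightarrow> a \<in> Hom C X X' \<Longrightarrow> b \<in> Hom C Y Y' \<Longrightarrow> b \<cdot> f = f' \<cdot> a
      \<Longrightarrow> \<exists>c \<in> Hom C Z Z'. c \<cdot> g = g' \<cdot> b \<and> Shift_map C a \<cdot> h = h' \<cdot> c"
    and TR4: "Triangle C X Y Z' f i i' \<Longrightarrow> Triangle C Y Z X' g j j'
      \<Longrightarrow> Triangle C X Z Y' (g \<cdot> f) l l'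
      \<Longrightarrow> \<exists>u v. Triangle C Z' Y' X' u v (Shift_map C i \<cdot> j') \<and>
            u \<cdot> i = l \<cdot> g \<and> l' \<cdot> u = i' \<and> v \<cdot> l = j \<and> j' \<cdot> v = Shift_map C f \<cdot> l'"

abbreviation Shift_n :: "('o, 'm, 'k) tri_cat \<Rightarrow> nat \<Rightarrow> 'o \<Rightarrow> 'o" where
  "Shift_n C n X \<equiv> (Shift C ^^ n) X"

abbreviation Shift_map_n :: "('o, 'm, 'k) tri_cat \<Rightarrow> nat \<Rightarrow> 'm \<Rightarrow> 'm" where
  "Shift_map_n C n f \<equiv> (Shift_map C ^^ n) f"

definition Ext :: "('o, 'm, 'k) tri_cat \<Rightarrow> nat \<Rightarrow> 'o \<Rightarrow> 'o \<Rightarrow> 'm set" where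
  "Ext C n X Y = Hom C X (Shift_n C n Y)"

definition linear_on ::
    "('k \<Rightarrow> 'a::ab_group_add \<Rightarrow> 'a) \<Rightarrow> ('k \<Rightarrow> 'b::ab_group_add \<Rightarrow> 'b) \<Rightarrow> 'a set \<Rightarrow> ('a \<Rightarrow> 'b) \<Rightarrow> bool" where
  "linear_on s s' V \<phi> \<longleftrightarrow> (\<forall>u\<in>V. \<forall>v\<in>V. \<phi> (u + v) = \<phi> u + \<phi> v) \<and>
     (\<forall>c. \<forall>u\<in>V. \<phi> (s c u) = s' c (\<phi> u))"

(* Functionals on a subspace V are extended by 0 outside V, so that functionals that agree
   on V are equal. *)
definition dual_space :: "('k::field \<Rightarrow> 'm::ab_group_add \<Rightarrow> 'm) \<Rightarrow> 'm set \<Rightarrow> ('m \<Rightarrow> 'k) set" where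
  "dual_space s V = {\<alpha>. linear_on s (*) V \<alpha> \<and> (\<forall>v. v \<notin> V \<longrightarrow> \<alpha> v = 0)}"

(* S X Y is the isomorphism from Hom(X,Y) to the dual of Hom(Y,X[d]); the first two conjuncts
   make it linear and bijective, the third one natural in X (along a) and in Y (along b). *)
definition calabi_yau :: "('o, 'm::ab_group_add, 'k::field) tri_cat \<Rightarrow> nat \<Rightarrow> bool" where
  "calabi_yau C d \<longleftrightarrow> (\<exists>S :: 'o \<Rightarrow> 'o \<Rightarrow> 'm \<Rightarrow> 'm \<Rightarrow> 'k.
     (\<forall>X Y. \<forall>v. linear_on (Scale C) (*) (Hom C X Y) (\<lambda>f. S X Y f v)) \<and>
     (\<forall>X Y. bij_betw (S X Y) (Hom C X Y) (dual_space (Scale C) (Hom C Y (Shift_n C d X)))) \<and>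
     (\<forall>X X' Y Y' a b f g. a \<in> Hom C X' X \<longrightarrow> b \<in> Hom C Y Y' \<longrightarrow> f \<in> Hom C X Y \<longrightarrow>
        g \<in> Hom C Y' (Shift_n C d X') \<longrightarrow>
        S X' Y' (b \<cdot>\<^bsub>C\<^esub> f \<cdot>\<^bsub>C\<^esub> a) g = S X Y f (Shift_map_n C d a \<cdot>\<^bsub>C\<^esub> g \<cdot>\<^bsub>C\<^esub> b)))"

section \<open>Subcategories\<close>

definition subcategory :: "('o, 'm::ab_group_add, 'k) tri_cat \<Rightarrow> 'o set \<Rightarrow> bool" where
  "subcategory C S \<longleftrightarrow>
     (\<forall>X Y. X \<in> S \<longrightarrow> isomorphic C X Y \<longrightarrow> Y \<in> S) \<and>
     (\<forall>Z. zero_object C Z \<longrightarrow> Z \<in> S) \<and>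
     (\<forall>A B X. A \<in> S \<longrightarrow> B \<in> S \<longrightarrow> is_biproduct C A B X \<longrightarrow> X \<in> S) \<and>
     (\<forall>A B X. X \<in> S \<longrightarrow> is_biproduct C A B X \<longrightarrow> A \<in> S \<and> B \<in> S)"

definition nonzero_subcategory :: "('o, 'm::zero, 'k) tri_cat \<Rightarrow> 'o set \<Rightarrow> bool" where
  "nonzero_subcategory C S \<longleftrightarrow> (\<exists>X\<in>S. \<not> zero_object C X)"

definition star :: "('o, 'm, 'k) tri_cat \<Rightarrow> 'o set \<Rightarrow> 'o set \<Rightarrow> 'o set" where
  "star C A B = {Z. \<exists>X\<in>A. \<exists>Y\<in>B. \<exists>f g h. Triangle C X Z Y f g h}"

definition shift_set :: "('o, 'm, 'k) tri_cat \<Rightarrow> nat \<Rightarrow> 'o set \<Rightarrow> 'o set" where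
  "shift_set C n S = {Z. \<exists>X\<in>S. isomorphic C Z (Shift_n C n X)}"

(* star_shifts C S n is S * S[1] * ... * S[n], bracketed to the left; by the octahedral axiom
   the bracketing is immaterial. *)
primrec star_shifts :: "('o, 'm, 'k) tri_cat \<Rightarrow> 'o set \<Rightarrow> nat \<Rightarrow> 'o set" where
  "star_shifts C S 0 = S"
| "star_shifts C S (Suc n) = star C (star_shifts C S n) (shift_set C (Suc n) S)"

(* Since the shift is an autoequivalence, Y[-1] is determined up to isomorphism as the
   object X with X[1] isomorphic to Y. *)
definition triangulated_subcategory :: "('o, 'm::ab_group_add, 'k) tri_cat \<Rightarrow> 'o set \<Rightarrow> bool" where
  "triangulated_subcategory C S \<longleftrightarrow> subcategory C S \<and>
     (\<forall>X\<in>S. Shift C X \<in> S) \<and>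
     (\<forall>X. \<forall>Y\<in>S. isomorphic C (Shift C X) Y \<longrightarrow> X \<in> S) \<and>
     star C S S \<subseteq> S"

section \<open>Cluster tilting subcategories\<close>

definition contravariantly_finite :: "('o, 'm, 'k) tri_cat \<Rightarrow> 'o set \<Rightarrow> 'o set \<Rightarrow> bool" where
  "contravariantly_finite C U T \<longleftrightarrow>
     (\<forall>X\<in>U. \<exists>T\<^sub>0\<in>T. \<exists>f \<in> Hom C T\<^sub>0 X. \<forall>T'\<in>T. \<forall>g \<in> Hom C T' X. \<exists>h \<in> Hom C T' T\<^sub>0. g = f \<cdot>\<^bsub>C\<^esub> h)"

definition covariantly_finite :: "('o, 'm, 'k) tri_cat \<Rightarrow> 'o set \<Rightarrow> 'o set \<Rightarrow> bool" where
  "covariantly_finite C U T \<longleftrightarrow>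
     (\<forall>X\<in>U. \<exists>T\<^sub>0\<in>T. \<exists>f \<in> Hom C X T\<^sub>0. \<forall>T'\<in>T. \<forall>g \<in> Hom C X T'. \<exists>h \<in> Hom C T\<^sub>0 T'. g = h \<cdot>\<^bsub>C\<^esub> f)"

(* T is d-cluster tilting in the triangulated subcategory U, which carries the triangulated
   structure inherited from C; U = UNIV is C itself. *)
definition cluster_tilting_in ::
    "('o, 'm::ab_group_add, 'k) tri_cat \<Rightarrow> nat \<Rightarrow> 'o set \<Rightarrow> 'o set \<Rightarrow> bool" where
  "cluster_tilting_in C d U T \<longleftrightarrow> subcategory C T \<and> T \<subseteq> U \<and>
     (\<forall>i\<in>{1..d-1}. \<forall>X\<in>T. \<forall>Y\<in>T. Ext C i X Y = {0}) \<and>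
     contravariantly_finite C U T \<and> covariantly_finite C U T \<and>
     (\<forall>X\<in>U. X \<in> T \<longleftrightarrow> (\<forall>i\<in>{1..d-1}. \<forall>Y\<in>T. Ext C i Y X = {0})) \<and>
     (\<forall>X\<in>U. X \<in> T \<longleftrightarrow> (\<forall>i\<in>{1..d-1}. \<forall>Y\<in>T. Ext C i X Y = {0}))"

section \<open>Direct sum decompositions\<close>

definition sums_of_components ::
    "('o, 'm::ab_group_add, 'k) tri_cat \<Rightarrow> 'o set \<Rightarrow> 'i set \<Rightarrow> ('i \<Rightarrow> 'o set) \<Rightarrow> bool" where
  "sums_of_components C S I F \<longleftrightarrow>
     (\<forall>X\<in>S. \<exists>J M. J \<subseteq> I \<and> (\<forall>i\<in>J. M i \<in> F i) \<and> is_direct_sum C J M X)"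

definition tri_direct_sum ::
    "('o, 'm::ab_group_add, 'k) tri_cat \<Rightarrow> 'o set \<Rightarrow> 'i set \<Rightarrow> ('i \<Rightarrow> 'o set) \<Rightarrow> bool" where
  "tri_direct_sum C U I Cs \<longleftrightarrow>
     (\<forall>i\<in>I. triangulated_subcategory C (Cs i) \<and> Cs i \<subseteq> U) \<and>
     sums_of_components C U I Cs \<and>
     (\<forall>i\<in>I. \<forall>j\<in>I. i \<noteq> j \<longrightarrow> (\<forall>X\<in>Cs i. \<forall>Y\<in>Cs j. Hom C X Y = {0}))"

definition tri_indecomposable :: "('o, 'm::ab_group_add, 'k) tri_cat \<Rightarrow> 'o set \<Rightarrow> bool" where
  "tri_indecomposable C U \<longleftrightarrow>
     \<not> (\<exists>F :: bool \<Rightarrow> 'o set. tri_direct_sum C U UNIV F \<and> (\<forall>b. nonzero_subcategory C (F b)))"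

definition ct_direct_sum ::
    "('o, 'm::ab_group_add, 'k) tri_cat \<Rightarrow> nat \<Rightarrow> 'o set \<Rightarrow> 'i set \<Rightarrow> ('i \<Rightarrow> 'o set) \<Rightarrow> bool" where
  "ct_direct_sum C d T I Ts \<longleftrightarrow>
     (\<forall>i\<in>I. subcategory C (Ts i) \<and> Ts i \<subseteq> T) \<and>
     sums_of_components C T I Ts \<and>
     (\<forall>i\<in>I. \<forall>j\<in>I. i \<noteq> j \<longrightarrow> (\<forall>X\<in>Ts i. \<forall>Y\<in>Ts j. Hom C X Y = {0})) \<and>
     (\<forall>i\<in>I. \<forall>j\<in>I. i \<noteq> j \<longrightarrow>
        (\<forall>t\<in>{1..d-2}. \<forall>X\<in>Ts i. \<forall>Y\<in>Ts j. Hom C (Shift_n C t X) Y = {0}))"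

definition ct_indecomposable :: "('o, 'm::ab_group_add, 'k) tri_cat \<Rightarrow> nat \<Rightarrow> 'o set \<Rightarrow> bool" where
  "ct_indecomposable C d T \<longleftrightarrow>
     \<not> (\<exists>F :: bool \<Rightarrow> 'o set. ct_direct_sum C d T UNIV F \<and> (\<forall>b. nonzero_subcategory C (F b)))"

definition tri_decomposition ::
    "('o, 'm::ab_group_add, 'k) tri_cat \<Rightarrow> 'i set \<Rightarrow> ('i \<Rightarrow> 'o set) \<Rightarrow> bool" where
  "tri_decomposition C I Cs \<longleftrightarrow>
     tri_direct_sum C UNIV I Cs \<and> (\<forall>i\<in>I. tri_indecomposable C (Cs i))"

definition ct_decomposition ::
    "('o, 'm::ab_group_add, 'k) tri_cat \<Rightarrow> nat \<Rightarrow> 'o set \<Rightarrow> 'i set \<Rightarrow> ('i \<Rightarrow> 'o set) \<Rightarrow> bool" where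
  "ct_decomposition C d T I Ts \<longleftrightarrow>
     ct_direct_sum C d T I Ts \<and> (\<forall>i\<in>I. ct_indecomposable C d (Ts i))"

end

(* Approximations show that T * T[1] * ... * T[d-1] is the whole category, so intersecting the
   components of a decomposition of C with T gives one of T, and C_i is recovered from T_i.

   Conversely let T be the direct sum of the T_i, and let C_i = T_i * ... * T_i[d-1].  Condition (3),
   the Calabi-Yau property and Ext^t(T,T) = 0 give Ext^1(C_i,C_j) = 0 for i distinct from j; this
   lets extensions of direct sums be rearranged componentwise, so every object is a direct sum of
   objects of the C_i.  The decomposition and duality also show that T_j[-1] lies in C_j, which yields
   the missing vanishing Hom(T_i[t],T_j) = 0 for t = d-1 and t = d.  Hence C_i consists of the
   objects without nonzero maps to the other C_j, and is triangulated.  Since nothing here uses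
   that the ambient category is C rather than a triangulated subcategory, indecomposability of C_i
   and of T_i correspond as well. *)

theory Submission
  imports Defs
begin

text \<open>The range of shifts governs the order of the proof. If C_i is filtered by T_i[s] and C_j
  by T_j[t] with s, t from 0 to d - 1, then Hom(C_i, C_j[1]) involves the differences (t + 1) - s
  from -(d - 2) to d. This is exactly what the hypotheses provide: condition (3) below 0, condition
  (2) at 0, Ext-vanishing in T from 1 to d - 1, and at d the dual of 0. Hom(C_i, C_j) needs the
  difference -(d - 1) as well, and Hom(C_i[1], C_j) needs -d. So Ext^1-orthogonality comes before
  Hom-orthogonality, and the splitting of objects obtained from it is what makes the latter
  accessible. Desuspension exists only up to isomorphism. Shifts are therefore natural numbers, both
  arguments of Hom carry one, and a statement about differences falls into two cases. Duality is
  applied in the form that Hom(X,Y) vanishes iff Hom(Y,X[d]) does. This concerns just two objects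
  and so holds inside every triangulated subcategory.\<close>

section \<open>Linear categories\<close>

context linear_category
begin

lemma zero_in_Hom [simp]: "0 \<in> Hom C X Y"
proof -
  interpret vector_space "Scale C" by (rule vector_space)
  show ?thesis using subspace_Hom[of X Y] by (rule subspace_0)
qed

lemma add_in_Hom: "f \<in> Hom C X Y \<Longrightarrow> g \<in> Hom C X Y \<Longrightarrow> f + g \<in> Hom C X Y"
proof -
  interpret vector_space "Scale C" by (rule vector_space)
  show "f \<in> Hom C X Y \<Longrightarrow> g \<in> Hom C X Y \<Longrightarrow> f + g \<in> Hom C X Y"
    using subspace_Hom[of X Y] by (rule subspace_add)
qed

lemma neg_in_Hom: "f \<in> Hom C X Y \<Longrightarrow> - f \<in> Hom C X Y"
proof -
  interpret vector_space "Scale C" by (rule vector_space)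
  show "f \<in> Hom C X Y \<Longrightarrow> - f \<in> Hom C X Y"
    using subspace_Hom[of X Y] by (rule subspace_neg)
qed

lemma diff_in_Hom: "f \<in> Hom C X Y \<Longrightarrow> g \<in> Hom C X Y \<Longrightarrow> f - g \<in> Hom C X Y"
  using add_in_Hom[OF _ neg_in_Hom, of f X Y g] by simp

lemma sum_in_Hom: "(\<And>j. j \<in> J \<Longrightarrow> f j \<in> Hom C X Y) \<Longrightarrow> sum f J \<in> Hom C X Y"
  by (induction J rule: infinite_finite_induct) (auto intro: add_in_Hom)

lemma Comp_zero_right: "g \<in> Hom C Y Z \<Longrightarrow> g \<cdot> 0 = 0"
  using Comp_add_right[of 0 Y Y 0 g Z] by simp

lemma Comp_zero_left: "f \<in> Hom C X Y \<Longrightarrow> 0 \<cdot> f = 0"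
  using Comp_add_left[of f X Y 0 Y 0] by simp

lemma Comp_neg_right: "f \<in> Hom C X Y \<Longrightarrow> g \<in> Hom C Y Z \<Longrightarrow> g \<cdot> (- f) = - (g \<cdot> f)"
  using Comp_add_right[of f X Y "- f" g Z] Comp_zero_right[of g Y Z] neg_in_Hom[of f X Y]
  by (simp add: eq_neg_iff_add_eq_0 add.commute)

lemma Comp_neg_left: "f \<in> Hom C X Y \<Longrightarrow> g \<in> Hom C Y Z \<Longrightarrow> (- g) \<cdot> f = - (g \<cdot> f)"
  using Comp_add_left[of f X Y g Z "- g"] Comp_zero_left[of f X Y] neg_in_Hom[of g Y Z]
  by (simp add: eq_neg_iff_add_eq_0 add.commute)

lemma Comp_diff_right: "f \<in> Hom C X Y \<Longrightarrow> f' \<in> Hom C X Y \<Longrightarrow> g \<in> Hom C Y Z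
    \<Longrightarrow> g \<cdot> (f - f') = g \<cdot> f - g \<cdot> f'"
  using Comp_add_right[of f X Y "- f'" g Z] neg_in_Hom[of f' X Y] Comp_neg_right[of f' X Y g Z]
  by simp

lemma Comp_diff_left: "f \<in> Hom C X Y \<Longrightarrow> g \<in> Hom C Y Z \<Longrightarrow> g' \<in> Hom C Y Z
    \<Longrightarrow> (g - g') \<cdot> f = g \<cdot> f - g' \<cdot> f"
  using Comp_add_left[of f X Y g Z "- g'"] neg_in_Hom[of g' Y Z] Comp_neg_left[of f X Y g' Z]
  by simp

lemma Comp_sum_right: "(\<And>j. j \<in> J \<Longrightarrow> f j \<in> Hom C X Y) \<Longrightarrow> g \<in> Hom C Y Z
    \<Longrightarrow> g \<cdot> sum f J = (\<Sum>j\<in>J. g \<cdot> f j)"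
proof (induction J rule: infinite_finite_induct)
  case (insert j J)
  then show ?case using Comp_add_right[of "f j" X Y "sum f J" g Z] sum_in_Hom[of J f X Y] by auto
qed (auto simp: Comp_zero_right)

lemma Comp_sum_left: "f \<in> Hom C X Y \<Longrightarrow> (\<And>j. j \<in> J \<Longrightarrow> g j \<in> Hom C Y Z)
    \<Longrightarrow> sum g J \<cdot> f = (\<Sum>j\<in>J. g j \<cdot> f)"
proof (induction J rule: infinite_finite_induct)
  case (insert j J)
  then show ?case using Comp_add_left[of f X Y "g j" Z "sum g J"] sum_in_Hom[of J g Y Z] by auto
qed (auto simp: Comp_zero_left)

lemma Hom_eq_zeroI: "(\<And>f. f \<in> Hom C X Y \<Longrightarrow> f = 0) \<Longrightarrow> Hom C X Y = {0}"
  by auto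

lemma Hom_zero_retract:
  assumes "Hom C X Y = {0}" "i \<in> Hom C A X" "p \<in> Hom C X A" "p \<cdot> i = Idn C A"
  shows "Hom C A Y = {0}"
proof (rule Hom_eq_zeroI)
  fix f assume f: "f \<in> Hom C A Y"
  have "f \<cdot> p = 0" using Comp_in_Hom[OF assms(3) f] assms(1) by auto
  then have "(f \<cdot> p) \<cdot> i = 0" using Comp_zero_left[OF assms(2)] by simp
  then show "f = 0" using Comp_assoc[OF assms(2,3) f] assms(4) Comp_Idn[OF f] by simp
qed

lemma Hom_zero_coretract:
  assumes "Hom C X Y = {0}" "i \<in> Hom C A Y" "p \<in> Hom C Y A" "p \<cdot> i = Idn C A"
  shows "Hom C X A = {0}"
proof (rule Hom_eq_zeroI)
  fix f assume f: "f \<in> Hom C X A"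
  have "i \<cdot> f = 0" using Comp_in_Hom[OF f assms(2)] assms(1) by auto
  then have "p \<cdot> (i \<cdot> f) = 0" using Comp_zero_right[OF assms(3)] by simp
  then show "f = 0" using Comp_assoc[OF f assms(2,3)] assms(4) Idn_Comp[OF f] by simp
qed

lemma isomorphicE:
  assumes "isomorphic C X Y"
  obtains f g where "f \<in> Hom C X Y" "g \<in> Hom C Y X" "g \<cdot> f = Idn C X" "f \<cdot> g = Idn C Y"
  using assms unfolding isomorphic_def is_iso_def by blast

lemma isomorphicI:
  "f \<in> Hom C X Y \<Longrightarrow> g \<in> Hom C Y X \<Longrightarrow> g \<cdot> f = Idn C X \<Longrightarrow> f \<cdot> g = Idn C Y
    \<Longrightarrow> isomorphic C X Y"
  unfolding isomorphic_def is_iso_def by blast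

lemma is_iso_Idn: "is_iso C X X (Idn C X)"
  unfolding is_iso_def using Idn_in_Hom[of X] Comp_Idn[OF Idn_in_Hom] by auto

lemma isomorphic_refl: "isomorphic C X X"
  using is_iso_Idn unfolding isomorphic_def by blast

lemma isomorphic_sym: "isomorphic C X Y \<Longrightarrow> isomorphic C Y X"
  unfolding isomorphic_def is_iso_def by blast

lemma isomorphic_trans:
  assumes "isomorphic C X Y" "isomorphic C Y Z" shows "isomorphic C X Z"
proof -
  obtain f g where f: "f \<in> Hom C X Y" "g \<in> Hom C Y X" "g \<cdot> f = Idn C X" "f \<cdot> g = Idn C Y"
    using assms(1) by (rule isomorphicE)
  obtain f' g' where f': "f' \<in> Hom C Y Z" "g' \<in> Hom C Z Y" "g' \<cdot> f' = Idn C Y" "f' \<cdot> g' = Idn C Z"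
    using assms(2) by (rule isomorphicE)
  have "(g \<cdot> g') \<cdot> (f' \<cdot> f) = g \<cdot> (g' \<cdot> (f' \<cdot> f))"
    using Comp_assoc[OF Comp_in_Hom[OF f(1) f'(1)] f'(2) f(2)] by simp
  also have "\<dots> = Idn C X"
    using Comp_assoc[OF f(1) f'(1) f'(2)] f'(3) Idn_Comp[OF f(1)] f(3) by simp
  finally have 1: "(g \<cdot> g') \<cdot> (f' \<cdot> f) = Idn C X" .
  have "(f' \<cdot> f) \<cdot> (g \<cdot> g') = f' \<cdot> (f \<cdot> (g \<cdot> g'))"
    using Comp_assoc[OF Comp_in_Hom[OF f'(2) f(2)] f(1) f'(1)] by simp
  also have "\<dots> = Idn C Z"
    using Comp_assoc[OF f'(2) f(2) f(1)] f(4) Idn_Comp[OF f'(2)] f'(4) by simp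
  finally have 2: "(f' \<cdot> f) \<cdot> (g \<cdot> g') = Idn C Z" .
  show ?thesis
    using isomorphicI[OF Comp_in_Hom[OF f(1) f'(1)] Comp_in_Hom[OF f'(2) f(2)] 1 2] .
qed

lemma Hom_zero_isomorphic:
  assumes "Hom C X Y = {0}" "isomorphic C X X'" "isomorphic C Y Y'"
  shows "Hom C X' Y' = {0}"
proof -
  obtain f g where f: "f \<in> Hom C X X'" "g \<in> Hom C X' X" "f \<cdot> g = Idn C X'"
    using assms(2) by (rule isomorphicE)
  obtain f' g' where f': "f' \<in> Hom C Y Y'" "g' \<in> Hom C Y' Y" "f' \<cdot> g' = Idn C Y'"
    using assms(3) by (rule isomorphicE)
  show ?thesis
    using Hom_zero_coretract[OF Hom_zero_retract[OF assms(1) f(2) f(1) f(3)] f'(2) f'(1) f'(3)] .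
qed

lemma zero_objectI:
  assumes "Idn C X = 0" shows "zero_object C X"
  unfolding zero_object_def
proof (intro allI conjI Hom_eq_zeroI)
  fix Y f assume f: "f \<in> Hom C Y X"
  show "f = 0" using Idn_Comp[OF f] Comp_zero_left[OF f] assms by simp
next
  fix Y f assume f: "f \<in> Hom C X Y"
  show "f = 0" using Comp_Idn[OF f] Comp_zero_right[OF f] assms by simp
qed

lemma zero_object_iff_Hom: "zero_object C X \<longleftrightarrow> Hom C X X = {0}"
  using zero_objectI[of X] Idn_in_Hom[of X] by (auto simp: zero_object_def)

section \<open>Direct sums\<close>

lemma is_direct_sumE:
  assumes "is_direct_sum C J M X"
  obtains inj pr where "finite J" "\<And>i. i \<in> J \<Longrightarrow> inj i \<in> Hom C (M i) X"
    "\<And>i. i \<in> J \<Longrightarrow> pr i \<in> Hom C X (M i)"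
    "\<And>i j. i \<in> J \<Longrightarrow> j \<in> J \<Longrightarrow> pr j \<cdot> inj i = (if i = j then Idn C (M i) else 0)"
    "(\<Sum>i\<in>J. inj i \<cdot> pr i) = Idn C X"
  using assms unfolding is_direct_sum_def by blast

lemma is_biproductI:
  assumes "i \<in> Hom C A X" "p \<in> Hom C X A" "s \<in> Hom C B X" "c \<in> Hom C X B"
    "p \<cdot> i = Idn C A" "c \<cdot> s = Idn C B" "p \<cdot> s = 0" "c \<cdot> i = 0" "i \<cdot> p + s \<cdot> c = Idn C X"
  shows "is_biproduct C A B X"
  unfolding is_biproduct_def is_direct_sum_def
  by (rule conjI, simp, rule exI[of _ "\<lambda>b. if b then i else s"], rule exI[of _ "\<lambda>b. if b then p else c"])
    (use assms in \<open>auto simp: UNIV_bool add.commute\<close>)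

lemma is_biproductE:
  assumes "is_biproduct C A B X"
  obtains i p s c where "i \<in> Hom C A X" "p \<in> Hom C X A" "s \<in> Hom C B X" "c \<in> Hom C X B"
    "p \<cdot> i = Idn C A" "c \<cdot> s = Idn C B" "p \<cdot> s = 0" "c \<cdot> i = 0" "i \<cdot> p + s \<cdot> c = Idn C X"
proof -
  obtain inj pr where h: "\<And>i. inj i \<in> Hom C (if i then A else B) X"
    "\<And>i. pr i \<in> Hom C X (if i then A else B)"
    "\<And>i j. pr j \<cdot> inj i = (if i = j then Idn C (if i then A else B) else 0)"
    "(\<Sum>i\<in>UNIV. inj i \<cdot> pr i) = Idn C X"
    using assms unfolding is_biproduct_def by (elim is_direct_sumE) auto
  show ?thesis
    using that[of "inj True" "pr True" "inj False" "pr False"] h(1,2)[of True] h(1,2)[of False]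
      h(3)[of True True] h(3)[of True False] h(3)[of False True] h(3)[of False False] h(4)
    by (auto simp: UNIV_bool add.commute)
qed

text \<open>The splitting maps \<open>s\<close> and \<open>c\<close> transport the structure maps of
  \<open>B\<close> to \<open>X\<close>. This is how a summand split off by a triangle becomes a new
  component at index \<open>k\<close>.\<close>

lemma is_direct_sum_insert:
  assumes "is_direct_sum C J M B" "k \<notin> J"
    "i \<in> Hom C A X" "p \<in> Hom C X A" "s \<in> Hom C B X" "c \<in> Hom C X B"
    "p \<cdot> i = Idn C A" "c \<cdot> s = Idn C B" "p \<cdot> s = 0" "c \<cdot> i = 0" "i \<cdot> p + s \<cdot> c = Idn C X"
  shows "is_direct_sum C (insert k J) (M(k := A)) X"
proof -
  obtain inj pr where J: "finite J" "\<And>i. i \<in> J \<Longrightarrow> inj i \<in> Hom C (M i) B"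
    "\<And>i. i \<in> J \<Longrightarrow> pr i \<in> Hom C B (M i)"
    "\<And>i j. i \<in> J \<Longrightarrow> j \<in> J \<Longrightarrow> pr j \<cdot> inj i = (if i = j then Idn C (M i) else 0)"
    "(\<Sum>i\<in>J. inj i \<cdot> pr i) = Idn C B"
    using is_direct_sumE[OF assms(1)] by blast
  define inj' where "inj' = (\<lambda>j. if j = k then i else s \<cdot> inj j)"
  define pr' where "pr' = (\<lambda>j. if j = k then p else pr j \<cdot> c)"
  have inj': "inj' j \<in> Hom C ((M(k := A)) j) X" if "j \<in> insert k J" for j
    using that J(2)[of j] assms(3,5) by (auto simp: inj'_def intro: Comp_in_Hom)
  have pr': "pr' j \<in> Hom C X ((M(k := A)) j)" if "j \<in> insert k J" for j
    using that J(3)[of j] assms(4,6) by (auto simp: pr'_def intro: Comp_in_Hom)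
  have eq: "pr' j \<cdot> inj' l = (if l = j then Idn C ((M(k := A)) l) else 0)"
    if "l \<in> insert k J" "j \<in> insert k J" for l j
  proof -
    have a: "(pr j \<cdot> c) \<cdot> (s \<cdot> inj l) = pr j \<cdot> inj l" if "j \<in> J" "l \<in> J"
    proof -
      have "(pr j \<cdot> c) \<cdot> (s \<cdot> inj l) = pr j \<cdot> (c \<cdot> (s \<cdot> inj l))"
        using Comp_assoc[OF Comp_in_Hom[OF J(2)[OF that(2)] assms(5)] assms(6) J(3)[OF that(1)]] .
      also have "c \<cdot> (s \<cdot> inj l) = inj l"
        using Comp_assoc[OF J(2)[OF that(2)] assms(5,6)] assms(8) Idn_Comp[OF J(2)[OF that(2)]] by simp
      finally show ?thesis .
    qed
    have b: "(pr j \<cdot> c) \<cdot> i = 0" if "j \<in> J"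
      using Comp_assoc[OF assms(3,6) J(3)[OF that]] assms(10) Comp_zero_right[OF J(3)[OF that]] by simp
    have c: "p \<cdot> (s \<cdot> inj l) = 0" if "l \<in> J"
      using Comp_assoc[OF J(2)[OF that] assms(5,4)] assms(9) Comp_zero_left[OF J(2)[OF that]] by simp
    show ?thesis
      using that a b c J(4)[of l j] assms(2,7) by (auto simp: inj'_def pr'_def)
  qed
  have "(\<Sum>j\<in>J. inj' j \<cdot> pr' j) = (\<Sum>j\<in>J. s \<cdot> ((inj j \<cdot> pr j) \<cdot> c))"
  proof (rule sum.cong)
    fix j assume j: "j \<in> J"
    have "(s \<cdot> inj j) \<cdot> (pr j \<cdot> c) = s \<cdot> (inj j \<cdot> (pr j \<cdot> c))"
      using Comp_assoc[OF Comp_in_Hom[OF assms(6) J(3)[OF j]] J(2)[OF j] assms(5)] .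
    then show "inj' j \<cdot> pr' j = s \<cdot> ((inj j \<cdot> pr j) \<cdot> c)"
      using j assms(2) Comp_assoc[OF assms(6) J(3)[OF j] J(2)[OF j]] by (auto simp: inj'_def pr'_def)
  qed simp
  also have "\<dots> = s \<cdot> ((\<Sum>j\<in>J. inj j \<cdot> pr j) \<cdot> c)"
  proof -
    have h: "inj j \<cdot> pr j \<in> Hom C B B" if "j \<in> J" for j
      using Comp_in_Hom[OF J(3)[OF that] J(2)[OF that]] .
    have "(\<Sum>j\<in>J. inj j \<cdot> pr j) \<cdot> c = (\<Sum>j\<in>J. (inj j \<cdot> pr j) \<cdot> c)"
      by (rule Comp_sum_left[OF assms(6) h])
    moreover have "s \<cdot> (\<Sum>j\<in>J. (inj j \<cdot> pr j) \<cdot> c) = (\<Sum>j\<in>J. s \<cdot> ((inj j \<cdot> pr j) \<cdot> c))"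
      by (rule Comp_sum_right[OF Comp_in_Hom[OF assms(6) h] assms(5)])
    ultimately show ?thesis by simp
  qed
  also have "\<dots> = s \<cdot> c" using J(5) Idn_Comp[OF assms(6)] by simp
  finally have "(\<Sum>j\<in>insert k J. inj' j \<cdot> pr' j) = Idn C X"
    using J(1) assms(2,11) by (simp add: inj'_def pr'_def)
  then show ?thesis unfolding is_direct_sum_def using J(1) inj' pr' eq
    by (intro conjI exI[of _ inj'] exI[of _ pr']) auto
qed

lemma is_direct_sum_insert_zero:
  assumes "is_direct_sum C J M X" "k \<notin> J" "zero_object C Z"
  shows "is_direct_sum C (insert k J) (M(k := Z)) X"
proof (rule is_direct_sum_insert[OF assms(1,2), where i = 0 and p = 0 and s = "Idn C X" and c = "Idn C X"])
  show "0 \<cdot> 0 = Idn C Z"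
    using assms(3) Idn_in_Hom[of Z] Comp_zero_left[of 0 X X] unfolding zero_object_def by auto
qed (auto simp: Idn_in_Hom Comp_Idn[OF Idn_in_Hom] Comp_zero_left[OF zero_in_Hom]
    Comp_zero_right[OF Idn_in_Hom] Comp_zero_left[OF Idn_in_Hom])

text \<open>The finite index sets of two objects need not agree. Padding with zero objects lets two
  decompositions run over a common set, or forces a prescribed index to occur.\<close>

lemma is_direct_sum_enlarge:
  assumes "finite L" "is_direct_sum C J M X" "\<And>k. k \<in> L \<Longrightarrow> \<exists>Z \<in> F k. zero_object C Z"
    "\<And>j. j \<in> J \<Longrightarrow> M j \<in> F j"
  shows "\<exists>M'. is_direct_sum C (J \<union> L) M' X \<and> (\<forall>j \<in> J \<union> L. M' j \<in> F j)"
  using assms(1,3)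
proof (induction L)
  case empty then show ?case using assms by auto
next
  case (insert k L)
  then obtain M' where M': "is_direct_sum C (J \<union> L) M' X" "\<forall>j \<in> J \<union> L. M' j \<in> F j" by auto
  show ?case
  proof (cases "k \<in> J")
    case True then show ?thesis using M' by (auto simp: insert_absorb)
  next
    case False
    obtain Z where Z: "Z \<in> F k" "zero_object C Z" using insert.prems by auto
    have "is_direct_sum C (insert k (J \<union> L)) (M'(k := Z)) X"
      using is_direct_sum_insert_zero[OF M'(1) _ Z(2)] False insert.hyps by auto
    then show ?thesis using M'(2) Z(1) by (intro exI[of _ "M'(k := Z)"]) (simp del: fun_upd_apply, simp)
  qed
qed

lemma zero_direct_sum_empty: "is_direct_sum C {} M X \<longleftrightarrow> zero_object C X"
  using zero_objectI[of X] Idn_in_Hom[of X] by (auto simp: is_direct_sum_def zero_object_def)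

end

section \<open>Triangles\<close>

context triangulated_category
begin

section \<open>The shift functor\<close>

lemma Shift_map_inject:
  "f \<in> Hom C X Y \<Longrightarrow> g \<in> Hom C X Y \<Longrightarrow> Shift_map C f = Shift_map C g \<Longrightarrow> f = g"
  using Shift_fully_faithful[of X Y] by (auto simp: bij_betw_def inj_on_def)

lemma Shift_map_surj:
  assumes "g \<in> Hom C (Shift C X) (Shift C Y)"
  obtains f where "f \<in> Hom C X Y" "Shift_map C f = g"
  using Shift_fully_faithful[of X Y] assms unfolding bij_betw_def by (metis imageE)

lemma Shift_map_zero: "Shift_map C 0 = 0"
  using Shift_map_add[of 0 undefined undefined 0] by simp

lemma isomorphic_Shift: "isomorphic C X Y \<Longrightarrow> isomorphic C (Shift C X) (Shift C Y)"
proof -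
  assume "isomorphic C X Y"
  then obtain f g where f: "f \<in> Hom C X Y" "g \<in> Hom C Y X" "g \<cdot> f = Idn C X" "f \<cdot> g = Idn C Y"
    by (rule isomorphicE)
  show ?thesis
  proof (rule isomorphicI)
    show "Shift_map C f \<in> Hom C (Shift C X) (Shift C Y)" using f Shift_map_in_Hom by blast
    show "Shift_map C g \<in> Hom C (Shift C Y) (Shift C X)" using f Shift_map_in_Hom by blast
    show "Shift_map C g \<cdot> Shift_map C f = Idn C (Shift C X)"
      using Shift_map_Comp[OF f(1,2)] f(3) Shift_map_Idn by simp
    show "Shift_map C f \<cdot> Shift_map C g = Idn C (Shift C Y)"
      using Shift_map_Comp[OF f(2,1)] f(4) Shift_map_Idn by simp
  qed
qed

lemma isomorphic_Shift_n: "isomorphic C X Y \<Longrightarrow> isomorphic C (Shift_n C n X) (Shift_n C n Y)"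
  by (induction n) (auto intro: isomorphic_Shift)

lemma Hom_Shift_zero_iff: "Hom C (Shift C X) (Shift C Y) = {0} \<longleftrightarrow> Hom C X Y = {0}"
proof
  assume "Hom C (Shift C X) (Shift C Y) = {0}"
  then show "Hom C X Y = {0}"
    using Shift_map_inject[OF _ zero_in_Hom, of _ X Y] Shift_map_in_Hom[of _ X Y] Shift_map_zero
    by (intro Hom_eq_zeroI) (metis singletonD)
next
  assume "Hom C X Y = {0}"
  then show "Hom C (Shift C X) (Shift C Y) = {0}"
    using Shift_map_zero by (intro Hom_eq_zeroI) (metis Shift_map_surj singletonD)
qed

lemma Hom_Shift_n_zero_iff: "Hom C (Shift_n C n X) (Shift_n C n Y) = {0} \<longleftrightarrow> Hom C X Y = {0}"
  by (induction n) (auto simp: Hom_Shift_zero_iff)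

lemma Shift_n_add: "Shift_n C (m + n) X = Shift_n C m (Shift_n C n X)"
  by (simp add: funpow_add)

lemma Shift_n_desuspend: "\<exists>X. isomorphic C (Shift_n C n X) Y"
proof (induction n arbitrary: Y)
  case 0 then show ?case using isomorphic_refl by auto
next
  case (Suc n)
  obtain Y' where Y': "isomorphic C (Shift C Y') Y" using Shift_ess_surj by blast
  obtain X where "isomorphic C (Shift_n C n X) Y'" using Suc by blast
  then show ?case using isomorphic_trans[OF isomorphic_Shift Y'] by auto
qed

lemma zero_object_Shift: "zero_object C X \<Longrightarrow> zero_object C (Shift C X)"
  by (simp add: zero_object_iff_Hom Hom_Shift_zero_iff)

section \<open>Isomorphism and rotation of triangles\<close>

lemma triangle_iso:
  assumes "Triangle C X Y Z f g h" "is_iso C X X' a" "is_iso C Y Y' b" "is_iso C Z Z' c"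
  shows "\<exists>f' g' h'. Triangle C X' Y' Z' f' g' h'"
proof -
  have fgh: "f \<in> Hom C X Y" "g \<in> Hom C Y Z" "h \<in> Hom C Z (Shift C X)"
    using Triangle_in_Hom[OF assms(1)] by auto
  obtain a' where a: "a \<in> Hom C X X'" "a' \<in> Hom C X' X" "a' \<cdot> a = Idn C X" "a \<cdot> a' = Idn C X'"
    using assms(2) unfolding is_iso_def by blast
  obtain b' where b: "b \<in> Hom C Y Y'" "b' \<in> Hom C Y' Y" "b' \<cdot> b = Idn C Y" "b \<cdot> b' = Idn C Y'"
    using assms(3) unfolding is_iso_def by blast
  obtain c' where c: "c \<in> Hom C Z Z'" "c' \<in> Hom C Z' Z" "c' \<cdot> c = Idn C Z" "c \<cdot> c' = Idn C Z'"
    using assms(4) unfolding is_iso_def by blast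
  have bf: "b \<cdot> f \<in> Hom C X Y'" and cg: "c \<cdot> g \<in> Hom C Y Z'"
    and ah: "Shift_map C a \<cdot> h \<in> Hom C Z (Shift C X')"
    using Comp_in_Hom[OF fgh(1) b(1)] Comp_in_Hom[OF fgh(2) c(1)]
      Comp_in_Hom[OF fgh(3) Shift_map_in_Hom[OF a(1)]] by auto
  show ?thesis
  proof (intro exI, rule TR1_iso[OF assms(1) _ _ _ assms(2-4)])
    show "b \<cdot> f \<cdot> a' \<in> Hom C X' Y'" using Comp_in_Hom[OF a(2) bf] .
    show "c \<cdot> g \<cdot> b' \<in> Hom C Y' Z'" using Comp_in_Hom[OF b(2) cg] .
    show "Shift_map C a \<cdot> h \<cdot> c' \<in> Hom C Z' (Shift C X')" using Comp_in_Hom[OF c(2) ah] .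
    show "b \<cdot> f = b \<cdot> f \<cdot> a' \<cdot> a" using Comp_assoc[OF a(1,2) bf] a(3) Comp_Idn[OF bf] by simp
    show "c \<cdot> g = c \<cdot> g \<cdot> b' \<cdot> b" using Comp_assoc[OF b(1,2) cg] b(3) Comp_Idn[OF cg] by simp
    show "Shift_map C a \<cdot> h = Shift_map C a \<cdot> h \<cdot> c' \<cdot> c"
      using Comp_assoc[OF c(1,2) ah] c(3) Comp_Idn[OF ah] by simp
  qed
qed

lemma triangle_isomorphic:
  assumes "Triangle C X Y Z f g h" "isomorphic C X X'" "isomorphic C Y Y'" "isomorphic C Z Z'"
  shows "\<exists>f' g' h'. Triangle C X' Y' Z' f' g' h'"
  using assms triangle_iso unfolding isomorphic_def by blast

lemma rotate: "Triangle C X Y Z f g h \<Longrightarrow> Triangle C Y Z (Shift C X) g h (- Shift_map C f)"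
  using TR2[of f X Y g Z h] Triangle_in_Hom[of X Y Z f g h] by blast

lemma unrotate:
  assumes "Triangle C Y Z (Shift C X) g h k"
  shows "\<exists>f. Triangle C X Y Z f g h"
proof -
  have k: "g \<in> Hom C Y Z" "h \<in> Hom C Z (Shift C X)" "k \<in> Hom C (Shift C X) (Shift C Y)"
    using Triangle_in_Hom[OF assms] by auto
  obtain f where f: "f \<in> Hom C X Y" "Shift_map C f = - k"
    using Shift_map_surj[OF neg_in_Hom[OF k(3)]] by blast
  then have "Triangle C X Y Z f g h" using TR2[OF f(1) k(1,2)] assms by simp
  then show ?thesis ..
qed

text \<open>The shift is only essentially surjective, so the cone is replaced by an isomorphic
  object \<open>Shift C W\<close> before the triangle is rotated back.\<close>

lemma ex_cocone:
  assumes "f \<in> Hom C X Y"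
  shows "\<exists>W k h. Triangle C W X Y k f h"
proof -
  obtain Z g h where T: "Triangle C X Y Z f g h" using TR1_cone[OF assms] by blast
  obtain W where W: "isomorphic C (Shift C W) Z" using Shift_ess_surj by blast
  obtain c c' where c: "c \<in> Hom C Z (Shift C W)" "c' \<in> Hom C (Shift C W) Z"
    "c' \<cdot> c = Idn C Z" "c \<cdot> c' = Idn C (Shift C W)"
    using isomorphic_sym[OF W] by (rule isomorphicE)
  have gh: "g \<in> Hom C Y Z" "h \<in> Hom C Z (Shift C X)" using Triangle_in_Hom[OF T] by auto
  have "Triangle C X Y (Shift C W) f (c \<cdot> g) (h \<cdot> c')"
  proof (rule TR1_iso[OF T assms _ _ is_iso_Idn is_iso_Idn])
    show "c \<cdot> g \<in> Hom C Y (Shift C W)" using Comp_in_Hom[OF gh(1) c(1)] .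
    show "h \<cdot> c' \<in> Hom C (Shift C W) (Shift C X)" using Comp_in_Hom[OF c(2) gh(2)] .
    show "is_iso C Z (Shift C W) c" using c unfolding is_iso_def by blast
    show "Idn C Y \<cdot> f = f \<cdot> Idn C X" using Comp_Idn Idn_Comp assms by simp
    show "c \<cdot> g = (c \<cdot> g) \<cdot> Idn C Y" using Comp_Idn[OF Comp_in_Hom[OF gh(1) c(1)]] by simp
    show "Shift_map C (Idn C X) \<cdot> h = h \<cdot> c' \<cdot> c"
      using Comp_assoc[OF c(1,2) gh(2)] c(3) Comp_Idn[OF gh(2)] Idn_Comp[OF gh(2)] Shift_map_Idn by simp
  qed
  then show ?thesis using unrotate by blast
qed

lemma triangle_zero_right: "zero_object C Z \<Longrightarrow> \<exists>f g h. Triangle C X X Z f g h"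
  using TR1_Idn by blast

lemma triangle_zero_left:
  assumes "zero_object C Z" shows "\<exists>f g h. Triangle C Z X X f g h"
proof -
  have "Triangle C X X (Shift C Z) (Idn C X) 0 0" using TR1_Idn[OF zero_object_Shift[OF assms]] .
  then show ?thesis using unrotate by blast
qed

section \<open>Exactness of Hom on triangles\<close>

text \<open>TR3, applied to the triangle on \<open>Idn C X\<close> with zero third object and the
  maps \<open>Idn C X\<close> and \<open>f\<close> into the given triangle, equates
  \<open>g \<cdot> f\<close> with a composite through zero.\<close>

lemma triangle_comp_zero:
  assumes "Triangle C X Y Z f g h" shows "g \<cdot> f = 0"
proof -
  have fgh: "f \<in> Hom C X Y" "g \<in> Hom C Y Z" using Triangle_in_Hom[OF assms] by auto
  obtain O' where O: "zero_object C O'" using ex_zero_object by blast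
  obtain c where "c \<in> Hom C O' Z" "c \<cdot> 0 = g \<cdot> f"
    using TR3[OF TR1_Idn[OF O, of X] assms Idn_in_Hom fgh(1)] by auto
  then show ?thesis using Comp_zero_right by metis
qed

text \<open>Read \<open>u\<close> as part of a morphism from W -> 0 -> W[1] to the rotated triangle
  Y -> Z -> X[1]. TR3 supplies a map W[1] -> X[1], which full faithfulness of the shift brings down
  to \<open>v\<close>.\<close>

lemma exact_left:
  assumes T: "Triangle C X Y Z f g h" and u: "u \<in> Hom C W Y" "g \<cdot> u = 0"
  obtains v where "v \<in> Hom C W X" "f \<cdot> v = u"
proof -
  have fgh: "f \<in> Hom C X Y" "g \<in> Hom C Y Z" "h \<in> Hom C Z (Shift C X)"
    using Triangle_in_Hom[OF T] by auto
  obtain O' where O: "zero_object C O'" using ex_zero_object by blast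
  have "Triangle C W O' (Shift C W) 0 0 (- Shift_map C (Idn C W))"
    using rotate[OF TR1_Idn[OF O, of W]] .
  note c = TR3[OF this rotate[OF T] u(1) zero_in_Hom]
  obtain c where c: "c \<in> Hom C (Shift C W) (Shift C X)"
    "Shift_map C u \<cdot> (- Shift_map C (Idn C W)) = (- Shift_map C f) \<cdot> c"
    using c u(2) Comp_zero_left[of 0 W O'] by auto
  obtain v where v: "v \<in> Hom C W X" "Shift_map C v = c" using c(1) by (rule Shift_map_surj)
  have su: "Shift_map C u \<in> Hom C (Shift C W) (Shift C Y)" using Shift_map_in_Hom[OF u(1)] .
  have sf: "Shift_map C f \<in> Hom C (Shift C X) (Shift C Y)" using Shift_map_in_Hom[OF fgh(1)] .
  have "- Shift_map C u = - (Shift_map C f \<cdot> c)"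
    using c(2) Comp_neg_right[OF Idn_in_Hom su] Comp_Idn[OF su] Shift_map_Idn Comp_neg_left[OF c(1) sf]
    by simp
  then have "Shift_map C (f \<cdot> v) = Shift_map C u" using Shift_map_Comp[OF v(1) fgh(1)] v(2) by simp
  then have "f \<cdot> v = u" using Shift_map_inject[OF Comp_in_Hom[OF v(1) fgh(1)] u(1)] by blast
  then show ?thesis using that v(1) by blast
qed

text \<open>With 0 -> W -> W as target triangle, the second map being the identity, TR3 produces the
  factorisation directly.\<close>

lemma exact_right:
  assumes T: "Triangle C X Y Z f g h" and u: "u \<in> Hom C Y W" "u \<cdot> f = 0"
  obtains v where "v \<in> Hom C Z W" "v \<cdot> g = u"
proof -
  have fgh: "f \<in> Hom C X Y" using Triangle_in_Hom[OF T] by auto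
  obtain O' where O: "zero_object C O'" using ex_zero_object by blast
  obtain p where p: "Triangle C O' W W p (Idn C W) 0"
    using unrotate[OF TR1_Idn[OF zero_object_Shift[OF O]]] by blast
  have "p \<in> Hom C O' W" using Triangle_in_Hom[OF p] by auto
  then have "u \<cdot> f = p \<cdot> 0" using u(2) Comp_zero_right by metis
  then obtain c where "c \<in> Hom C Z W" "c \<cdot> g = Idn C W \<cdot> u"
    using TR3[OF T p zero_in_Hom u(1)] by auto
  then show ?thesis using that Idn_Comp[OF u(1)] by simp
qed

lemma Hom_zero_triangle_left:
  assumes "Triangle C X Y Z f g h" "Hom C X W = {0}" "Hom C Z W = {0}"
  shows "Hom C Y W = {0}"
proof (rule Hom_eq_zeroI)
  fix u assume u: "u \<in> Hom C Y W"
  have fg: "f \<in> Hom C X Y" "g \<in> Hom C Y Z" using Triangle_in_Hom[OF assms(1)] by auto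
  have "u \<cdot> f = 0" using Comp_in_Hom[OF fg(1) u] assms(2) by auto
  then obtain v where "v \<in> Hom C Z W" "v \<cdot> g = u" using exact_right[OF assms(1) u] by blast
  then show "u = 0" using assms(3) Comp_zero_left[OF fg(2)] by auto
qed

lemma Hom_zero_triangle_right:
  assumes "Triangle C X Y Z f g h" "Hom C W X = {0}" "Hom C W Z = {0}"
  shows "Hom C W Y = {0}"
proof (rule Hom_eq_zeroI)
  fix u assume u: "u \<in> Hom C W Y"
  have fg: "f \<in> Hom C X Y" "g \<in> Hom C Y Z" using Triangle_in_Hom[OF assms(1)] by auto
  have "g \<cdot> u = 0" using Comp_in_Hom[OF u fg(2)] assms(3) by auto
  then obtain v where "v \<in> Hom C W X" "f \<cdot> v = u" using exact_left[OF assms(1) u] by blast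
  then show "u = 0" using assms(2) Comp_zero_right[OF fg(1)] by auto
qed

section \<open>Split triangles and complements of summands\<close>

text \<open>The zero third map makes \<open>c\<close> right-cancellable: a map whose composite with
  \<open>c\<close> vanishes factors through it. The idempotent complementary to
  \<open>i \<cdot> p\<close> factors through \<open>c\<close> and gives \<open>s\<close>; the
  identities for \<open>s\<close> follow by cancelling \<open>c\<close>.\<close>

lemma split_triangle:
  assumes T: "Triangle C X Z Y i c 0" and p: "p \<in> Hom C Z X" "p \<cdot> i = Idn C X"
  shows "\<exists>s \<in> Hom C Y Z. c \<cdot> s = Idn C Y \<and> p \<cdot> s = 0 \<and> i \<cdot> p + s \<cdot> c = Idn C Z"
proof -
  have ic: "i \<in> Hom C X Z" "c \<in> Hom C Z Y" using Triangle_in_Hom[OF T] by auto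
  have epi: "u = 0" if u: "u \<in> Hom C Y W" "u \<cdot> c = 0" for u W
  proof -
    obtain w where "w \<in> Hom C (Shift C X) W" "w \<cdot> 0 = u" using exact_right[OF rotate[OF T] u] by blast
    then show ?thesis using Comp_zero_right by metis
  qed
  have ip: "i \<cdot> p \<in> Hom C Z Z" using Comp_in_Hom[OF p(1) ic(1)] .
  have e: "Idn C Z - i \<cdot> p \<in> Hom C Z Z" using diff_in_Hom[OF Idn_in_Hom ip] .
  have "(Idn C Z - i \<cdot> p) \<cdot> i = 0"
    using Comp_diff_left[OF ic(1) Idn_in_Hom ip] Idn_Comp[OF ic(1)] Comp_assoc[OF ic(1) p(1) ic(1)] p(2)
      Comp_Idn[OF ic(1)] by simp
  then obtain s where s: "s \<in> Hom C Y Z" "s \<cdot> c = Idn C Z - i \<cdot> p" using exact_right[OF T e] by blast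
  have ci: "c \<cdot> i = 0" using triangle_comp_zero[OF T] .
  have "(c \<cdot> s) \<cdot> c = c"
    using Comp_assoc[OF ic(2) s(1) ic(2)] s(2) Comp_diff_right[OF Idn_in_Hom ip ic(2)] Comp_Idn[OF ic(2)]
      Comp_assoc[OF p(1) ic] ci Comp_zero_left[OF p(1)] by simp
  then have "(c \<cdot> s - Idn C Y) \<cdot> c = 0"
    using Comp_diff_left[OF ic(2) Comp_in_Hom[OF s(1) ic(2)] Idn_in_Hom] Idn_Comp[OF ic(2)] by simp
  then have 1: "c \<cdot> s = Idn C Y"
    using epi[OF diff_in_Hom[OF Comp_in_Hom[OF s(1) ic(2)] Idn_in_Hom]] by simp
  have "(p \<cdot> s) \<cdot> c = 0"
    using Comp_assoc[OF ic(2) s(1) p(1)] s(2) Comp_diff_right[OF Idn_in_Hom ip p(1)] Comp_Idn[OF p(1)]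
      Comp_assoc[OF p(1) ic(1) p(1)] p(2) Idn_Comp[OF p(1)] by simp
  then have "p \<cdot> s = 0" using epi[OF Comp_in_Hom[OF s(1) p(1)]] by simp
  then show ?thesis using 1 s by auto
qed

text \<open>Consecutive maps of a triangle compose to zero, so \<open>Shift_map C i\<close> kills
  \<open>h\<close>. It has the left inverse \<open>Shift_map C p\<close>, hence \<open>h = 0\<close>
  and the cone is a complement of \<open>A\<close>.\<close>

lemma retract_split:
  assumes i: "i \<in> Hom C A X" and p: "p \<in> Hom C X A" and pi: "p \<cdot> i = Idn C A"
  shows "\<exists>B s c. Triangle C A X B i c 0 \<and> s \<in> Hom C B X \<and> c \<in> Hom C X B \<and>
    c \<cdot> s = Idn C B \<and> p \<cdot> s = 0 \<and> c \<cdot> i = 0 \<and> i \<cdot> p + s \<cdot> c = Idn C X"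
proof -
  obtain B c h where T: "Triangle C A X B i c h" using TR1_cone[OF i] by blast
  have ch: "c \<in> Hom C X B" "h \<in> Hom C B (Shift C A)" using Triangle_in_Hom[OF T] by auto
  have si: "Shift_map C i \<in> Hom C (Shift C A) (Shift C X)" and sp: "Shift_map C p \<in> Hom C (Shift C X) (Shift C A)"
    using Shift_map_in_Hom i p by auto
  have "(- Shift_map C i) \<cdot> h = 0" using triangle_comp_zero[OF rotate[OF rotate[OF T]]] .
  then have "Shift_map C i \<cdot> h = 0" using Comp_neg_left[OF ch(2) si] by simp
  then have "(Shift_map C p \<cdot> Shift_map C i) \<cdot> h = 0"
    using Comp_assoc[OF ch(2) si sp] Comp_zero_right[OF sp] by simp
  then have "h = 0" using Shift_map_Comp[OF i p] pi Shift_map_Idn Idn_Comp[OF ch(2)] by simp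
  with T have T: "Triangle C A X B i c 0" by simp
  then show ?thesis using split_triangle[OF T p pi] triangle_comp_zero[OF T] ch(1) by blast
qed

text \<open>The map \<open>h\<close> lies in the vanishing group, so \<open>g\<close> has a section
  \<open>t\<close>. The idempotent complementary to \<open>t \<cdot> g\<close> factors through
  \<open>f\<close> and gives the retraction \<open>p\<close>, for which
  \<open>split_triangle\<close> then chooses a matching section.\<close>

lemma Ext1_zero_split:
  assumes T: "Triangle C X Z Y f g h" and E: "Hom C Y (Shift C X) = {0}"
  obtains p s where "p \<in> Hom C Z X" "s \<in> Hom C Y Z" "p \<cdot> f = Idn C X" "g \<cdot> s = Idn C Y" "p \<cdot> s = 0"
    "g \<cdot> f = 0" "f \<cdot> p + s \<cdot> g = Idn C Z"
proof -
  have fgh: "f \<in> Hom C X Z" "g \<in> Hom C Z Y" "h \<in> Hom C Y (Shift C X)"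
    using Triangle_in_Hom[OF T] by auto
  then have h: "h = 0" using E by auto
  have mono: "u = 0" if u: "u \<in> Hom C W X" "f \<cdot> u = 0" for u W
  proof -
    have su: "Shift_map C u \<in> Hom C (Shift C W) (Shift C X)" using Shift_map_in_Hom[OF u(1)] .
    have "(- Shift_map C f) \<cdot> Shift_map C u = 0"
      using Comp_neg_left[OF su Shift_map_in_Hom[OF fgh(1)]] Shift_map_Comp[OF u(1) fgh(1)] u(2)
        Shift_map_zero by simp
    then obtain w where "w \<in> Hom C (Shift C W) Y" "h \<cdot> w = Shift_map C u"
      using exact_left[OF rotate[OF rotate[OF T]] su] by blast
    then have "Shift_map C u = Shift_map C 0" using h Comp_zero_left Shift_map_zero by metis
    then show ?thesis using Shift_map_inject[OF u(1) zero_in_Hom] by blast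
  qed
  have "h \<cdot> Idn C Y = 0" using h Comp_zero_left[OF Idn_in_Hom] by simp
  then obtain t where t: "t \<in> Hom C Y Z" "g \<cdot> t = Idn C Y"
    using exact_left[OF rotate[OF T] Idn_in_Hom] by blast
  have tg: "t \<cdot> g \<in> Hom C Z Z" using Comp_in_Hom[OF fgh(2) t(1)] .
  have "g \<cdot> (Idn C Z - t \<cdot> g) = 0"
    using Comp_diff_right[OF Idn_in_Hom tg fgh(2)] Comp_Idn[OF fgh(2)] Comp_assoc[OF fgh(2) t(1) fgh(2)]
      t(2) Idn_Comp[OF fgh(2)] by simp
  then obtain p where p: "p \<in> Hom C Z X" "f \<cdot> p = Idn C Z - t \<cdot> g"
    using exact_left[OF T diff_in_Hom[OF Idn_in_Hom tg]] by blast
  have gf: "g \<cdot> f = 0" using triangle_comp_zero[OF T] .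
  have "f \<cdot> (p \<cdot> f) = f"
    using Comp_assoc[OF fgh(1) p(1) fgh(1)] p(2) Comp_diff_left[OF fgh(1) Idn_in_Hom tg]
      Idn_Comp[OF fgh(1)] Comp_assoc[OF fgh(1,2) t(1)] gf Comp_zero_right[OF t(1)] by simp
  then have "f \<cdot> (p \<cdot> f - Idn C X) = 0"
    using Comp_diff_right[OF Comp_in_Hom[OF fgh(1) p(1)] Idn_in_Hom fgh(1)] Comp_Idn[OF fgh(1)] by simp
  then have pf: "p \<cdot> f = Idn C X"
    using mono[OF diff_in_Hom[OF Comp_in_Hom[OF fgh(1) p(1)] Idn_in_Hom]] by simp
  have "Triangle C X Z Y f g 0" using T h by simp
  from split_triangle[OF this p(1) pf] show ?thesis using that[OF p(1) _ pf] gf by blast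
qed

text \<open>Inverse to \<open>is_direct_sum_insert\<close>. The complement is produced as a cone, so
  the same \<open>B\<close> is a direct summand and the third term of a triangle; the latter turns
  direct sums into extensions.\<close>

lemma is_direct_sum_peel:
  assumes "is_direct_sum C (insert k J) M X" "k \<notin> J"
  shows "\<exists>B. (\<exists>f g h. Triangle C (M k) X B f g h) \<and> is_biproduct C (M k) B X \<and> is_direct_sum C J M B"
proof -
  obtain inj pr where J: "finite (insert k J)" "\<And>i. i \<in> insert k J \<Longrightarrow> inj i \<in> Hom C (M i) X"
    "\<And>i. i \<in> insert k J \<Longrightarrow> pr i \<in> Hom C X (M i)"
    "\<And>i j. i \<in> insert k J \<Longrightarrow> j \<in> insert k J \<Longrightarrow> pr j \<cdot> inj i = (if i = j then Idn C (M i) else 0)"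
    "(\<Sum>i\<in>insert k J. inj i \<cdot> pr i) = Idn C X"
    using is_direct_sumE[OF assms(1)] by blast
  define i p where "i = inj k" and "p = pr k"
  have i: "i \<in> Hom C (M k) X" and p: "p \<in> Hom C X (M k)" and pi: "p \<cdot> i = Idn C (M k)"
    using J(2,3,4)[of k] by (auto simp: i_def p_def)
  obtain B s c where T: "Triangle C (M k) X B i c 0" and s: "s \<in> Hom C B X" and c: "c \<in> Hom C X B"
    and cs: "c \<cdot> s = Idn C B" and ps: "p \<cdot> s = 0" and ci: "c \<cdot> i = 0" and e: "i \<cdot> p + s \<cdot> c = Idn C X"
    using retract_split[OF i p pi] by blast
  have sc: "s \<cdot> c = Idn C X - i \<cdot> p" using e by (simp add: algebra_simps)
  have ip: "i \<cdot> p \<in> Hom C X X" using Comp_in_Hom[OF p i] .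
  \<comment> \<open>The other inclusions already land in the complement because \<open>p\<close>
    kills them, so passing through \<open>c\<close> and \<open>s\<close> changes nothing.\<close>
  have sci: "(s \<cdot> c) \<cdot> inj l = inj l" if l: "l \<in> J" for l
  proof -
    have il: "inj l \<in> Hom C (M l) X" using J(2) l by auto
    have "p \<cdot> inj l = 0" using J(4)[of l k] l assms(2) by (auto simp: p_def)
    then show ?thesis
      using sc Comp_diff_left[OF il Idn_in_Hom ip] Idn_Comp[OF il] Comp_assoc[OF il p i] Comp_zero_right[OF i]
      by simp
  qed
  have "is_direct_sum C J M B" unfolding is_direct_sum_def
  proof (rule conjI[rotated], rule exI[of _ "\<lambda>j. c \<cdot> inj j"], rule exI[of _ "\<lambda>j. pr j \<cdot> s"],
      intro conjI ballI)
    show "finite J" using J(1) by simp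
    show "c \<cdot> inj j \<in> Hom C (M j) B" if "j \<in> J" for j using Comp_in_Hom[OF J(2) c] that by auto
    show "pr j \<cdot> s \<in> Hom C B (M j)" if "j \<in> J" for j using Comp_in_Hom[OF s J(3)] that by auto
    show "(pr j \<cdot> s) \<cdot> (c \<cdot> inj l) = (if l = j then Idn C (M l) else 0)" if "l \<in> J" "j \<in> J" for l j
    proof -
      have il: "inj l \<in> Hom C (M l) X" and pj: "pr j \<in> Hom C X (M j)" using J(2,3) that by auto
      have "(pr j \<cdot> s) \<cdot> (c \<cdot> inj l) = pr j \<cdot> (s \<cdot> (c \<cdot> inj l))"
        using Comp_assoc[OF Comp_in_Hom[OF il c] s pj] .
      also have "s \<cdot> (c \<cdot> inj l) = inj l" using Comp_assoc[OF il c s] sci[OF that(1)] by simp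
      finally show ?thesis using J(4) that by auto
    qed
    have h: "inj j \<cdot> pr j \<in> Hom C X X" if "j \<in> J" for j using Comp_in_Hom[OF J(3) J(2)] that by blast
    have sum: "(\<Sum>j\<in>J. inj j \<cdot> pr j) = Idn C X - i \<cdot> p"
      using J(1,5) assms(2) by (simp add: i_def p_def algebra_simps)
    have "(\<Sum>j\<in>J. (c \<cdot> inj j) \<cdot> (pr j \<cdot> s)) = (\<Sum>j\<in>J. c \<cdot> ((inj j \<cdot> pr j) \<cdot> s))"
    proof (rule sum.cong)
      fix j assume "j \<in> J"
      then have ij: "inj j \<in> Hom C (M j) X" and pj: "pr j \<in> Hom C X (M j)" using J(2,3) by auto
      show "(c \<cdot> inj j) \<cdot> (pr j \<cdot> s) = c \<cdot> ((inj j \<cdot> pr j) \<cdot> s)"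
        using Comp_assoc[OF Comp_in_Hom[OF s pj] ij c] Comp_assoc[OF s pj ij] by simp
    qed simp
    also have "\<dots> = c \<cdot> (\<Sum>j\<in>J. (inj j \<cdot> pr j) \<cdot> s)"
      by (rule Comp_sum_right[OF Comp_in_Hom[OF s h] c, symmetric])
    also have "\<dots> = c \<cdot> ((\<Sum>j\<in>J. inj j \<cdot> pr j) \<cdot> s)"
      by (rule arg_cong[of _ _ "\<lambda>u. c \<cdot> u"], rule Comp_sum_left[OF s h, symmetric])
    also have "\<dots> = c \<cdot> (s - i \<cdot> (p \<cdot> s))"
      using sum Comp_diff_left[OF s Idn_in_Hom ip] Idn_Comp[OF s] Comp_assoc[OF s p i] by simp
    also have "\<dots> = Idn C B" using ps Comp_zero_right[OF i] cs by simp
    finally show "(\<Sum>j\<in>J. (c \<cdot> inj j) \<cdot> (pr j \<cdot> s)) = Idn C B" .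
  qed
  moreover have "is_biproduct C (M k) B X" using is_biproductI[OF i p s c pi cs ps ci e] .
  ultimately show ?thesis using T by blast
qed

section \<open>Rebracketing and interchanging extensions\<close>

text \<open>TR4 for the composite A -> E -> Z. In terms of extension products, (A * B) * D is
  contained in A * (B * D).\<close>

lemma octahedron_assoc_right:
  assumes "Triangle C A E B f g h" "Triangle C E Z D f' g' h'"
  shows "\<exists>Y. (\<exists>a b c. Triangle C A Z Y a b c) \<and> (\<exists>a b c. Triangle C B Y D a b c)"
proof -
  have "f' \<cdot> f \<in> Hom C A Z" using Triangle_in_Hom[OF assms(1)] Triangle_in_Hom[OF assms(2)] Comp_in_Hom by blast
  then obtain Y l l' where "Triangle C A Z Y (f' \<cdot> f) l l'" using TR1_cone by blast
  then show ?thesis using TR4[OF assms] by blast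
qed

text \<open>The converse rebracketing, from TR4 for Z -> E -> D. The input triangles are rotated
  once, and the resulting triangle of shifted objects is rotated back.\<close>

lemma octahedron_assoc_left:
  assumes "Triangle C A Z E f g h" "Triangle C B E D f' g' h'"
  shows "\<exists>Q. (\<exists>a b c. Triangle C A Q B a b c) \<and> (\<exists>a b c. Triangle C Q Z D a b c)"
proof -
  have g: "g' \<cdot> g \<in> Hom C Z D" using Triangle_in_Hom[OF assms(1)] Triangle_in_Hom[OF assms(2)] Comp_in_Hom by blast
  then obtain Q k l where Q: "Triangle C Q Z D k (g' \<cdot> g) l" using ex_cocone by blast
  obtain u v w where "Triangle C (Shift C A) (Shift C Q) (Shift C B) u v w"
    using TR4[OF rotate[OF assms(1)] rotate[OF assms(2)] rotate[OF Q]] by blast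
  then obtain a b c where "Triangle C A Q B a b c" using unrotate by meson
  then show ?thesis using Q by blast
qed

text \<open>The composite B -> E -> A[1] vanishes, so B -> E lifts to \<open>v\<close> along Z -> E.
  TR4 for this factorisation moves B to the front: A * (B * D) lands in B * (A * D).\<close>

lemma octahedron_swap:
  assumes "Triangle C A Z E f g h" "Triangle C B E D f' g' h'" "Hom C B (Shift C A) = {0}"
  shows "\<exists>Q. (\<exists>a b c. Triangle C B Z Q a b c) \<and> (\<exists>a b c. Triangle C A Q D a b c)"
proof -
  have m: "f' \<in> Hom C B E" "h \<in> Hom C E (Shift C A)" "g \<in> Hom C Z E"
    using Triangle_in_Hom[OF assms(1)] Triangle_in_Hom[OF assms(2)] by auto
  have "h \<cdot> f' = 0" using Comp_in_Hom[OF m(1,2)] assms(3) by auto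
  then obtain v where v: "v \<in> Hom C B Z" "g \<cdot> v = f'" using exact_left[OF rotate[OF assms(1)] m(1)] by blast
  obtain Q a b where Q: "Triangle C B Z Q v a b" using TR1_cone[OF v(1)] by blast
  obtain a b c where "Triangle C Q D (Shift C A) a b c"
    using TR4[OF Q rotate[OF assms(1)]] assms(2) v(2) by blast
  then show ?thesis using Q unrotate by meson
qed

lemma triangle_Shift:
  assumes "Triangle C X Y Z f g h"
  shows "\<exists>f g h. Triangle C (Shift C X) (Shift C Y) (Shift C Z) f g h"
  using rotate[OF rotate[OF rotate[OF assms]]] by blast

lemma triangle_Shift_n:
  assumes "Triangle C X Y Z f g h"
  shows "\<exists>f g h. Triangle C (Shift_n C n X) (Shift_n C n Y) (Shift_n C n Z) f g h"
proof (induction n)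
  case 0 then show ?case using assms by auto
next
  case (Suc n) then show ?case using triangle_Shift by auto
qed

section \<open>Direct sums as iterated extensions\<close>

text \<open>Peeling off one summand at a time by a triangle reduces a finite direct sum to zero
  objects and extensions.\<close>

lemma is_direct_sum_induct [consumes 1, case_names zero extension summand]:
  assumes "is_direct_sum C J M X" "\<And>Z. zero_object C Z \<Longrightarrow> P Z"
    "\<And>X Y Z f g h. Triangle C X Z Y f g h \<Longrightarrow> P X \<Longrightarrow> P Y \<Longrightarrow> P Z" "\<And>j. j \<in> J \<Longrightarrow> P (M j)"
  shows "P X"
proof -
  have "finite J" using assms(1) by (simp add: is_direct_sum_def)
  then show ?thesis using assms(1,4)
  proof (induction J arbitrary: X)
    case empty then show ?case using assms(2) by (simp add: zero_direct_sum_empty)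
  next
    case (insert k J)
    obtain B f g h where T: "Triangle C (M k) X B f g h" and B: "is_direct_sum C J M B"
      using is_direct_sum_peel[OF insert.prems(1) insert.hyps(2)] by blast
    have "P B" using insert.IH[OF B] insert.prems(2) by simp
    then show ?case using assms(3)[OF T] insert.prems(2) by simp
  qed
qed

lemma Hom_zero_zero_object: "zero_object C Z \<Longrightarrow> Hom C X Z = {0}" "zero_object C Z \<Longrightarrow> Hom C Z X = {0}"
  by (auto simp: zero_object_def)

lemma Hom_Shift_zero_triangle:
  assumes "Triangle C X Z Y f g h" "Hom C W (Shift C X) = {0}" "Hom C W (Shift C Y) = {0}"
  shows "Hom C W (Shift C Z) = {0}"
  using triangle_Shift[OF assms(1)] assms(2,3) Hom_zero_triangle_right by blast

lemma Hom_Shift_zero_direct_sum_right: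
  assumes "is_direct_sum C J M X" "\<And>j. j \<in> J \<Longrightarrow> Hom C W (Shift C (M j)) = {0}"
  shows "Hom C W (Shift C X) = {0}"
  using assms
proof (induction rule: is_direct_sum_induct)
  case (zero Z) then show ?case using zero_object_Shift Hom_zero_zero_object by blast
next
  case (extension X Y Z f g h) then show ?case using Hom_Shift_zero_triangle by blast
qed auto

lemma Hom_zero_direct_sum_left:
  assumes "is_direct_sum C J M X" "\<And>j. j \<in> J \<Longrightarrow> Hom C (M j) W = {0}"
  shows "Hom C X W = {0}"
  using assms
proof (induction rule: is_direct_sum_induct)
  case (zero Z) then show ?case using Hom_zero_zero_object by blast
next
  case (extension X Y Z f g h) then show ?case using Hom_zero_triangle_left by blast
qed auto

text \<open>The orthogonality in the hypotheses allows to interchange the two middle factors in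
  $(M_k * X') * (N_k * Y')$.\<close>

lemma extension_of_direct_sums:
  assumes "finite J" "is_direct_sum C J M X" "is_direct_sum C J N Y" "Triangle C X Z Y f g h"
    and "\<And>i j. i \<in> J \<Longrightarrow> j \<in> J \<Longrightarrow> i \<noteq> j \<Longrightarrow>
      Hom C (M i) (Shift C (M j)) = {0} \<and> Hom C (M i) (Shift C (N j)) = {0} \<and>
      Hom C (N i) (Shift C (M j)) = {0} \<and> Hom C (N i) (Shift C (N j)) = {0}"
  shows "\<exists>P. is_direct_sum C J P Z \<and> (\<forall>j\<in>J. \<exists>a b c. Triangle C (M j) (P j) (N j) a b c)"
  using assms
proof (induction J arbitrary: X Y Z f g h)
  case empty
  then have "zero_object C X" "zero_object C Y" by (simp_all add: zero_direct_sum_empty)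
  then have "Hom C Z Z = {0}"
    using Hom_zero_triangle_left[OF empty.prems(3)] Hom_zero_zero_object(2) by blast
  then show ?case by (simp add: zero_direct_sum_empty zero_object_iff_Hom)
next
  case (insert k J)
  have ex: "Hom C (M i) (Shift C (M j)) = {0}" "Hom C (M i) (Shift C (N j)) = {0}"
    "Hom C (N i) (Shift C (M j)) = {0}" "Hom C (N i) (Shift C (N j)) = {0}"
    if "i \<in> insert k J" "j \<in> insert k J" "i \<noteq> j" for i j
    using insert.prems(4)[OF that] by auto
  obtain X' f1 g1 h1 where X': "Triangle C (M k) X X' f1 g1 h1" "is_direct_sum C J M X'"
    using is_direct_sum_peel[OF insert.prems(1) insert.hyps(2)] by blast
  obtain Y' f2 g2 h2 where Y': "Triangle C (N k) Y Y' f2 g2 h2" "is_direct_sum C J N Y'"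
    using is_direct_sum_peel[OF insert.prems(2) insert.hyps(2)] by blast
  \<comment> \<open>At this point Z lies in M_k * (X' * (N_k * Y')). The swap and the rebracketing
    below turn this into (M_k * N_k) * (X' * Y'), with outer factors R and Q.\<close>
  obtain V f3 g3 h3 f4 g4 h4 where V: "Triangle C (M k) Z V f3 g3 h3" "Triangle C X' V Y f4 g4 h4"
    using octahedron_assoc_right[OF X'(1) insert.prems(3)] by blast
  have "Hom C (N k) (Shift C X') = {0}"
    by (rule Hom_Shift_zero_direct_sum_right[OF X'(2)], rule ex(3)) (use insert.hyps(2) in auto)
  then obtain Q f5 g5 h5 f6 g6 h6 where Q: "Triangle C (N k) V Q f5 g5 h5" "Triangle C X' Q Y' f6 g6 h6"
    using octahedron_swap[OF V(2) Y'(1)] by blast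
  obtain R f7 g7 h7 f8 g8 h8 where R: "Triangle C (M k) R (N k) f7 g7 h7" "Triangle C R Z Q f8 g8 h8"
    using octahedron_assoc_left[OF V(1) Q(1)] by blast
  obtain P where P: "is_direct_sum C J P Q" "\<forall>j\<in>J. \<exists>a b c. Triangle C (M j) (P j) (N j) a b c"
    using insert.IH[OF X'(2) Y'(2) Q(2) insert.prems(4)] by blast
  \<comment> \<open>All four cross terms vanish, hence Hom(Q, R[1]) = 0 and the triangle R -> Z -> Q
    splits.\<close>
  have "Hom C X' (Shift C (M k)) = {0}"
    by (rule Hom_zero_direct_sum_left[OF X'(2)], rule ex(1)) (use insert.hyps(2) in auto)
  moreover have "Hom C X' (Shift C (N k)) = {0}"
    by (rule Hom_zero_direct_sum_left[OF X'(2)], rule ex(2)) (use insert.hyps(2) in auto)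
  moreover have "Hom C Y' (Shift C (M k)) = {0}"
    by (rule Hom_zero_direct_sum_left[OF Y'(2)], rule ex(3)) (use insert.hyps(2) in auto)
  moreover have "Hom C Y' (Shift C (N k)) = {0}"
    by (rule Hom_zero_direct_sum_left[OF Y'(2)], rule ex(4)) (use insert.hyps(2) in auto)
  ultimately have "Hom C Q (Shift C R) = {0}"
    using Hom_Shift_zero_triangle[OF R(1)] Hom_zero_triangle_left[OF Q(2)] by simp
  from Ext1_zero_split[OF R(2) this] obtain p s where "p \<in> Hom C Z R" "s \<in> Hom C Q Z"
    "p \<cdot> f8 = Idn C R" "g8 \<cdot> s = Idn C Q" "p \<cdot> s = 0" "g8 \<cdot> f8 = 0" "f8 \<cdot> p + s \<cdot> g8 = Idn C Z" .
  moreover have "f8 \<in> Hom C R Z" "g8 \<in> Hom C Z Q" using Triangle_in_Hom[OF R(2)] by auto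
  ultimately have "is_direct_sum C (insert k J) (P(k := R)) Z"
    by (intro is_direct_sum_insert[OF P(1) insert.hyps(2)])
  moreover have "\<forall>j\<in>insert k J. \<exists>a b c. Triangle C (M j) ((P(k := R)) j) (N j) a b c"
    using P(2) R(1) insert.hyps(2) by auto
  ultimately show ?case by blast
qed

section \<open>Shifted direct sums and maps concentrated in one summand\<close>

lemma is_direct_sum_Shift:
  assumes "is_direct_sum C J M X"
  shows "is_direct_sum C J (\<lambda>j. Shift C (M j)) (Shift C X)"
proof -
  obtain inj pr where J: "finite J" "\<And>i. i \<in> J \<Longrightarrow> inj i \<in> Hom C (M i) X"
    "\<And>i. i \<in> J \<Longrightarrow> pr i \<in> Hom C X (M i)"
    "\<And>i j. i \<in> J \<Longrightarrow> j \<in> J \<Longrightarrow> pr j \<cdot> inj i = (if i = j then Idn C (M i) else 0)"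
    "(\<Sum>i\<in>J. inj i \<cdot> pr i) = Idn C X"
    using is_direct_sumE[OF assms] by blast
  have sum: "Shift_map C (sum u L) = (\<Sum>j\<in>L. Shift_map C (u j))"
    if "finite L" "\<And>j. j \<in> L \<Longrightarrow> u j \<in> Hom C X X" for u L
    using that
  proof (induction L)
    case empty then show ?case using Shift_map_zero by simp
  next
    case (insert j L)
    then show ?case using Shift_map_add[of "u j" X X "sum u L"] sum_in_Hom[of L u X X] by auto
  qed
  show ?thesis unfolding is_direct_sum_def
  proof (rule conjI[rotated], rule exI[of _ "\<lambda>j. Shift_map C (inj j)"],
      rule exI[of _ "\<lambda>j. Shift_map C (pr j)"], intro conjI ballI)
    show "finite J" using J(1) .
    show "Shift_map C (inj j) \<in> Hom C (Shift C (M j)) (Shift C X)" if "j \<in> J" for j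
      using Shift_map_in_Hom J(2) that by blast
    show "Shift_map C (pr j) \<in> Hom C (Shift C X) (Shift C (M j))" if "j \<in> J" for j
      using Shift_map_in_Hom J(3) that by blast
    show "Shift_map C (pr j) \<cdot> Shift_map C (inj i) = (if i = j then Idn C (Shift C (M i)) else 0)"
      if "i \<in> J" "j \<in> J" for i j
      using Shift_map_Comp[OF J(2)[OF that(1)] J(3)[OF that(2)]] J(4)[OF that] Shift_map_Idn Shift_map_zero
      by auto
    have "(\<Sum>j\<in>J. Shift_map C (inj j) \<cdot> Shift_map C (pr j)) = (\<Sum>j\<in>J. Shift_map C (inj j \<cdot> pr j))"
      by (rule sum.cong[OF refl], rule Shift_map_Comp[OF J(3) J(2), symmetric])
    moreover have "Shift_map C (\<Sum>j\<in>J. inj j \<cdot> pr j) = (\<Sum>j\<in>J. Shift_map C (inj j \<cdot> pr j))"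
      by (rule sum[OF J(1)], rule Comp_in_Hom[OF J(3) J(2)])
    ultimately show "(\<Sum>j\<in>J. Shift_map C (inj j) \<cdot> Shift_map C (pr j)) = Idn C (Shift C X)"
      using J(5) Shift_map_Idn by simp
  qed
qed

lemma is_direct_sum_Shift_n:
  "is_direct_sum C J M X \<Longrightarrow> is_direct_sum C J (\<lambda>j. Shift_n C n (M j)) (Shift_n C n X)"
proof (induction n)
  case (Suc n)
  then show ?case using is_direct_sum_Shift[of J "\<lambda>j. Shift_n C n (M j)" "Shift_n C n X"] by simp
qed simp

text \<open>In the expansion of the identity as a sum of idempotents, every term but one factors
  through a vanishing Hom group. This and its dual cut approximations down to a single
  component.\<close>

lemma direct_sum_factor_right:
  assumes "finite J" "\<And>i. i \<in> J \<Longrightarrow> inc i \<in> Hom C (M i) X" "\<And>i. i \<in> J \<Longrightarrow> pr i \<in> Hom C X (M i)"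
    "(\<Sum>i\<in>J. inc i \<cdot> pr i) = Idn C X" "k \<in> J" "h \<in> Hom C W X"
    "\<And>j. j \<in> J \<Longrightarrow> j \<noteq> k \<Longrightarrow> Hom C W (M j) = {0}"
  shows "inc k \<cdot> (pr k \<cdot> h) = h"
proof -
  have ip: "inc j \<cdot> pr j \<in> Hom C X X" if "j \<in> J" for j using Comp_in_Hom assms(2,3) that by blast
  have "h = (\<Sum>j\<in>J. inc j \<cdot> pr j) \<cdot> h" using assms(4) Idn_Comp[OF assms(6)] by simp
  also have "\<dots> = (\<Sum>j\<in>J. (inc j \<cdot> pr j) \<cdot> h)" by (rule Comp_sum_left[OF assms(6) ip])
  also have "\<dots> = (\<Sum>j\<in>J. if j = k then inc k \<cdot> (pr k \<cdot> h) else 0)"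
  proof (rule sum.cong)
    fix j assume j: "j \<in> J"
    have "pr j \<cdot> h = 0" if "j \<noteq> k" using Comp_in_Hom[OF assms(6) assms(3)[OF j]] assms(7)[OF j that] by auto
    then show "(inc j \<cdot> pr j) \<cdot> h = (if j = k then inc k \<cdot> (pr k \<cdot> h) else 0)"
      using Comp_assoc[OF assms(6) assms(3)[OF j] assms(2)[OF j]] Comp_zero_right[OF assms(2)[OF j]] by auto
  qed simp
  finally show ?thesis using assms(1,5) by simp
qed

lemma direct_sum_factor_left:
  assumes "finite J" "\<And>i. i \<in> J \<Longrightarrow> inc i \<in> Hom C (M i) X" "\<And>i. i \<in> J \<Longrightarrow> pr i \<in> Hom C X (M i)"
    "(\<Sum>i\<in>J. inc i \<cdot> pr i) = Idn C X" "k \<in> J" "h \<in> Hom C X W"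
    "\<And>j. j \<in> J \<Longrightarrow> j \<noteq> k \<Longrightarrow> Hom C (M j) W = {0}"
  shows "(h \<cdot> inc k) \<cdot> pr k = h"
proof -
  have ip: "inc j \<cdot> pr j \<in> Hom C X X" if "j \<in> J" for j using Comp_in_Hom assms(2,3) that by blast
  have "h = h \<cdot> (\<Sum>j\<in>J. inc j \<cdot> pr j)" using assms(4) Comp_Idn[OF assms(6)] by simp
  also have "\<dots> = (\<Sum>j\<in>J. h \<cdot> (inc j \<cdot> pr j))" by (rule Comp_sum_right[OF ip assms(6)])
  also have "\<dots> = (\<Sum>j\<in>J. if j = k then (h \<cdot> inc k) \<cdot> pr k else 0)"
  proof (rule sum.cong)
    fix j assume j: "j \<in> J"
    have "h \<cdot> inc j = 0" if "j \<noteq> k" using Comp_in_Hom[OF assms(2)[OF j] assms(6)] assms(7)[OF j that] by auto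
    then show "h \<cdot> (inc j \<cdot> pr j) = (if j = k then (h \<cdot> inc k) \<cdot> pr k else 0)"
      using Comp_assoc[OF assms(3)[OF j] assms(2)[OF j] assms(6)] Comp_zero_left[OF assms(3)[OF j]] by auto
  qed simp
  finally show ?thesis using assms(1,5) by simp
qed

text \<open>Apply \<open>direct_sum_factor_right\<close> to the identity of \<open>X\<close>: only
  the summand at \<open>k\<close> survives.\<close>

lemma ex_isomorphic_component:
  assumes "is_direct_sum C J M X" "\<And>j. j \<in> J \<Longrightarrow> M j \<in> F j" "\<exists>Z\<in>F k. zero_object C Z"
    "\<And>j. j \<in> J \<Longrightarrow> j \<noteq> k \<Longrightarrow> Hom C X (M j) = {0}"
  shows "\<exists>A\<in>F k. isomorphic C X A"
proof -
  \<comment> \<open>A zero object is inserted at \<open>k\<close> if this index is missing. Building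
    the Hom condition into the family preserves it under the padding.\<close>
  have "\<exists>N. is_direct_sum C (J \<union> {k}) N X \<and> (\<forall>j \<in> J \<union> {k}. N j \<in> {Y\<in>F j. j \<noteq> k \<longrightarrow> Hom C X Y = {0}})"
    using is_direct_sum_enlarge[OF _ assms(1), of "{k}" "\<lambda>j. {Y\<in>F j. j \<noteq> k \<longrightarrow> Hom C X Y = {0}}"] assms(2-4)
    by auto
  then obtain N where N: "is_direct_sum C (J \<union> {k}) N X"
    "\<forall>j \<in> J \<union> {k}. N j \<in> F j \<and> (j \<noteq> k \<longrightarrow> Hom C X (N j) = {0})" by blast
  obtain inj pr where J: "finite (J \<union> {k})" "\<And>i. i \<in> J \<union> {k} \<Longrightarrow> inj i \<in> Hom C (N i) X"
    "\<And>i. i \<in> J \<union> {k} \<Longrightarrow> pr i \<in> Hom C X (N i)"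
    "\<And>i j. i \<in> J \<union> {k} \<Longrightarrow> j \<in> J \<union> {k} \<Longrightarrow> pr j \<cdot> inj i = (if i = j then Idn C (N i) else 0)"
    "(\<Sum>i\<in>J \<union> {k}. inj i \<cdot> pr i) = Idn C X"
    using is_direct_sumE[OF N(1)] by blast
  have k: "k \<in> J \<union> {k}" by simp
  have "inj k \<cdot> (pr k \<cdot> Idn C X) = Idn C X"
    by (rule direct_sum_factor_right[OF J(1-3,5) k Idn_in_Hom]) (use N(2) in auto)
  then have "inj k \<cdot> pr k = Idn C X" using Comp_Idn[OF J(3)[OF k]] by simp
  then have "isomorphic C X (N k)" using isomorphicI[OF J(3)[OF k] J(2)[OF k]] J(4)[OF k k] by simp
  then show ?thesis using N(2) by blast
qed

section \<open>Subcategories\<close>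

lemma subcategory_isomorphic: "subcategory C S \<Longrightarrow> X \<in> S \<Longrightarrow> isomorphic C X Y \<Longrightarrow> Y \<in> S"
  unfolding subcategory_def by blast

lemma subcategory_zero_object: "subcategory C S \<Longrightarrow> zero_object C Z \<Longrightarrow> Z \<in> S"
  unfolding subcategory_def by blast

lemma subcategory_zero: "subcategory C S \<Longrightarrow> \<exists>Z\<in>S. zero_object C Z"
  unfolding subcategory_def using ex_zero_object by blast

text \<open>The closure conditions speak of biproducts; the complement of a retract is the cone from
  \<open>retract_split\<close>.\<close>

lemma subcategory_retract:
  assumes "subcategory C S" "X \<in> S" "i \<in> Hom C A X" "p \<in> Hom C X A" "p \<cdot> i = Idn C A"
  shows "A \<in> S"
proof -
  obtain B s c where "s \<in> Hom C B X" "c \<in> Hom C X B" "c \<cdot> s = Idn C B" "p \<cdot> s = 0" "c \<cdot> i = 0"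
    "i \<cdot> p + s \<cdot> c = Idn C X"
    using retract_split[OF assms(3-5)] by blast
  then have "is_biproduct C A B X" using is_biproductI[OF assms(3,4)] assms(5) by blast
  then show ?thesis using assms(1,2) unfolding subcategory_def by blast
qed

lemma subcategory_summand:
  assumes "subcategory C S" "X \<in> S" "is_direct_sum C J M X" "k \<in> J" shows "M k \<in> S"
  using assms(3)
proof (rule is_direct_sumE)
  fix inj pr assume "\<And>i. i \<in> J \<Longrightarrow> inj i \<in> Hom C (M i) X" "\<And>i. i \<in> J \<Longrightarrow> pr i \<in> Hom C X (M i)"
    "\<And>i j. i \<in> J \<Longrightarrow> j \<in> J \<Longrightarrow> pr j \<cdot> inj i = (if i = j then Idn C (M i) else 0)"
  then show "M k \<in> S" using subcategory_retract[OF assms(1,2), of "inj k" "M k" "pr k"] assms(4) by simp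
qed

lemma subcategory_Int: "subcategory C S \<Longrightarrow> subcategory C S' \<Longrightarrow> subcategory C (S \<inter> S')"
  unfolding subcategory_def by blast

lemma triangulated_subcategory_UNIV: "triangulated_subcategory C UNIV"
  unfolding triangulated_subcategory_def subcategory_def by auto

lemma triangulated_subcategoryD:
  assumes "triangulated_subcategory C U"
  shows "subcategory C U" "X \<in> U \<Longrightarrow> Shift C X \<in> U"
    "Y \<in> U \<Longrightarrow> isomorphic C (Shift C X) Y \<Longrightarrow> X \<in> U"
    "Triangle C X Z Y f g h \<Longrightarrow> X \<in> U \<Longrightarrow> Y \<in> U \<Longrightarrow> Z \<in> U"
  using assms unfolding triangulated_subcategory_def star_def by blast+

lemma triangulated_subcategory_Shift_n:
  "triangulated_subcategory C U \<Longrightarrow> X \<in> U \<Longrightarrow> Shift_n C n X \<in> U"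
  by (induction n) (auto intro: triangulated_subcategoryD)

lemma triangulated_subcategory_unshift:
  "triangulated_subcategory C U \<Longrightarrow> Shift_n C n X \<in> U \<Longrightarrow> X \<in> U"
  by (induction n) (auto intro: triangulated_subcategoryD(3)[OF _ _ isomorphic_refl])

lemma triangulated_subcategory_cocone:
  assumes U: "triangulated_subcategory C U" and T: "Triangle C X Y Z f g h" and "Y \<in> U" "Z \<in> U"
  shows "X \<in> U"
proof -
  have "Shift C X \<in> U"
    using triangulated_subcategoryD(4)[OF U rotate[OF rotate[OF T]] assms(4)]
      triangulated_subcategoryD(2)[OF U assms(3)] by blast
  then show ?thesis using triangulated_subcategory_unshift[OF U, of 1] by simp
qed

section \<open>Iterated extensions of shifts\<close>

lemma star_shifts_isomorphic:
  assumes "subcategory C S" "X \<in> star_shifts C S n" "isomorphic C X Y"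
  shows "Y \<in> star_shifts C S n"
proof (cases n)
  case 0 then show ?thesis using assms subcategory_isomorphic by auto
next
  case (Suc m)
  then show ?thesis
    using assms(2,3) triangle_isomorphic[OF _ isomorphic_refl _ isomorphic_refl, of _ X _ _ _ _ Y]
    unfolding Suc star_shifts.simps star_def by blast
qed

lemma star_shifts_induct [consumes 1, case_names shift isomorphic extension]:
  assumes "X \<in> star_shifts C S n" "\<And>A s. A \<in> S \<Longrightarrow> s \<le> n \<Longrightarrow> P (Shift_n C s A)"
    "\<And>X Y. isomorphic C X Y \<Longrightarrow> P X \<Longrightarrow> P Y"
    "\<And>X Y Z f g h. Triangle C X Z Y f g h \<Longrightarrow> P X \<Longrightarrow> P Y \<Longrightarrow> P Z"
  shows "P X"
  using assms(1,2)
proof (induction n arbitrary: X)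
  case 0 then show ?case using "0.prems"(2)[of X 0] by simp
next
  case (Suc n)
  obtain X' Y A f g h where T: "X' \<in> star_shifts C S n" "A \<in> S" "isomorphic C Y (Shift_n C (Suc n) A)"
    "Triangle C X' X Y f g h"
    using Suc.prems(1) unfolding star_shifts.simps star_def shift_set_def by blast
  have "P X'" using Suc.IH[OF T(1)] Suc.prems(2) by simp
  moreover have "P Y" using assms(3)[OF isomorphic_sym[OF T(3)]] Suc.prems(2)[OF T(2)] by blast
  ultimately show ?case using assms(4)[OF T(4)] by blast
qed

lemma star_shifts_mono_Suc:
  assumes "subcategory C S" "X \<in> star_shifts C S n" shows "X \<in> star_shifts C S (Suc n)"
proof -
  obtain Z where Z: "Z \<in> S" "zero_object C Z" using subcategory_zero[OF assms(1)] by blast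
  have "zero_object C (Shift_n C (Suc n) Z)" using Z(2) by (simp add: zero_object_iff_Hom Hom_Shift_zero_iff Hom_Shift_n_zero_iff)
  then obtain f g h where "Triangle C X X (Shift_n C (Suc n) Z) f g h" using triangle_zero_right by blast
  moreover have "Shift_n C (Suc n) Z \<in> shift_set C (Suc n) S"
    using Z(1) isomorphic_refl unfolding shift_set_def by blast
  ultimately show ?thesis using assms(2) unfolding star_shifts.simps star_def by blast
qed

lemma subset_star_shifts: "subcategory C S \<Longrightarrow> S \<subseteq> star_shifts C S n"
  using star_shifts_mono_Suc by (induction n) auto

text \<open>A zero object fills the factors before the last one.\<close>

lemma Shift_n_in_star_shifts:
  assumes "subcategory C S" "A \<in> S" shows "Shift_n C n A \<in> star_shifts C S n"
proof (cases n)
  case 0 then show ?thesis using assms by simp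
next
  case (Suc m)
  obtain Z where Z: "Z \<in> S" "zero_object C Z" using subcategory_zero[OF assms(1)] by blast
  obtain f g h where "Triangle C Z (Shift_n C n A) (Shift_n C n A) f g h"
    using triangle_zero_left[OF Z(2)] by blast
  moreover have "Shift_n C n A \<in> shift_set C n S"
    using assms(2) isomorphic_refl unfolding shift_set_def by blast
  ultimately show ?thesis
    using subset_star_shifts[OF assms(1), of m] Z(1) unfolding Suc star_shifts.simps(2) star_def by blast
qed

lemma star_shifts_subset:
  assumes "triangulated_subcategory C U" "S \<subseteq> U" shows "star_shifts C S n \<subseteq> U"
proof
  fix X assume "X \<in> star_shifts C S n"
  then show "X \<in> U"
  proof (induction rule: star_shifts_induct)
    case (shift A s) then show ?case using assms triangulated_subcategory_Shift_n by blast
  next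
    case (isomorphic X Y)
    then show ?case using triangulated_subcategoryD(1)[OF assms(1)] subcategory_isomorphic by blast
  next
    case (extension X Y Z f g h) then show ?case using triangulated_subcategoryD(4)[OF assms(1)] by blast
  qed
qed

lemma Hom_zero_star_shifts_left:
  assumes "X \<in> star_shifts C S n" "\<And>A s. A \<in> S \<Longrightarrow> s \<le> n \<Longrightarrow> Hom C (Shift_n C a (Shift_n C s A)) W = {0}"
  shows "Hom C (Shift_n C a X) W = {0}"
  using assms
proof (induction rule: star_shifts_induct)
  case (isomorphic X Y)
  then show ?case using Hom_zero_isomorphic[OF _ isomorphic_Shift_n isomorphic_refl] by blast
next
  case (extension X Y Z f g h)
  then show ?case using triangle_Shift_n[OF extension.hyps, of a] Hom_zero_triangle_left by blast
qed auto

lemma Hom_zero_star_shifts_right: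
  assumes "X \<in> star_shifts C S n" "\<And>A s. A \<in> S \<Longrightarrow> s \<le> n \<Longrightarrow> Hom C W (Shift_n C a (Shift_n C s A)) = {0}"
  shows "Hom C W (Shift_n C a X) = {0}"
  using assms
proof (induction rule: star_shifts_induct)
  case (isomorphic X Y)
  then show ?case using Hom_zero_isomorphic[OF _ isomorphic_refl isomorphic_Shift_n] by blast
next
  case (extension X Y Z f g h)
  then show ?case using triangle_Shift_n[OF extension.hyps, of a] Hom_zero_triangle_right by blast
qed auto

text \<open>Filtering both arguments reduces vanishing between iterated extensions to a bounded
  range of shifts of generators. The offsets \<open>a\<close> and \<open>b\<close> stand in for a
  negative shift of either side.\<close>

lemma Hom_zero_star_shifts:
  assumes "X \<in> star_shifts C S m" "Y \<in> star_shifts C S' n"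
    "\<And>A B s t. A \<in> S \<Longrightarrow> B \<in> S' \<Longrightarrow> s \<le> m \<Longrightarrow> t \<le> n \<Longrightarrow>
      Hom C (Shift_n C (a + s) A) (Shift_n C (b + t) B) = {0}"
  shows "Hom C (Shift_n C a X) (Shift_n C b Y) = {0}"
  by (rule Hom_zero_star_shifts_left[OF assms(1)], rule Hom_zero_star_shifts_right[OF assms(2)])
    (use assms(3) in \<open>simp add: Shift_n_add\<close>)

lemma Hom_Shift_n_diff_right:
  assumes "s \<le> t"
  shows "Hom C (Shift_n C s X) (Shift_n C t Y) = {0} \<longleftrightarrow> Hom C X (Shift_n C (t - s) Y) = {0}"
  using Hom_Shift_n_zero_iff[of s X "Shift_n C (t - s) Y"] Shift_n_add[of s "t - s" Y] assms by simp

lemma Hom_Shift_n_diff_left: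
  assumes "t \<le> s"
  shows "Hom C (Shift_n C s X) (Shift_n C t Y) = {0} \<longleftrightarrow> Hom C (Shift_n C (s - t) X) Y = {0}"
  using Hom_Shift_n_zero_iff[of t "Shift_n C (s - t) X" Y] Shift_n_add[of t "s - t" X] assms by simp

section \<open>The Calabi-Yau property\<close>

text \<open>The zero space has no functional but 0, and a nonzero vector is detected by some
  functional; so a space vanishes iff its dual does.\<close>

lemma calabi_yau_Hom_zero_iff:
  assumes "calabi_yau C d"
  shows "Hom C X Y = {0} \<longleftrightarrow> Hom C Y (Shift_n C d X) = {0}"
proof -
  let ?V = "Hom C Y (Shift_n C d X)"
  let ?D = "dual_space (Scale C) ?V"
  obtain S :: "'o \<Rightarrow> 'o \<Rightarrow> 'm \<Rightarrow> 'm \<Rightarrow> 'k" where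
    "\<forall>X Y. bij_betw (S X Y) (Hom C X Y) (dual_space (Scale C) (Hom C Y (Shift_n C d X)))"
    using assms unfolding calabi_yau_def by blast
  then have bij: "bij_betw (S X Y) (Hom C X Y) ?D" by blast
  have zero: "(\<lambda>_. 0) \<in> ?D" by (auto simp: dual_space_def linear_on_def)
  show ?thesis
  proof
    assume V: "?V = {0}"
    have "\<alpha> = (\<lambda>_. 0)" if "\<alpha> \<in> ?D" for \<alpha>
    proof
      fix v
      have "\<alpha> (0 + 0) = \<alpha> 0 + \<alpha> 0" "v \<noteq> 0 \<Longrightarrow> \<alpha> v = 0"
        using that V unfolding dual_space_def linear_on_def by auto
      then show "\<alpha> v = 0" by (metis add.right_neutral add_left_cancel)
    qed
    then have "S X Y f = S X Y 0" if "f \<in> Hom C X Y" for f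
      using bij that unfolding bij_betw_def by (metis imageI zero_in_Hom)
    then show "Hom C X Y = {0}"
      using bij unfolding bij_betw_def inj_on_def by (intro Hom_eq_zeroI) (metis zero_in_Hom)
  next
    assume H: "Hom C X Y = {0}"
    have D: "\<alpha> = (\<lambda>_. 0)" if "\<alpha> \<in> ?D" for \<alpha>
      using bij zero that H unfolding bij_betw_def by (metis imageE singletonD)
    show "?V = {0}"
    proof (rule Hom_eq_zeroI, rule ccontr)
      fix v assume v: "v \<in> ?V" "v \<noteq> 0"
      interpret vs: vector_space "Scale C" by (rule vector_space)
      interpret k: vector_space "(*) :: 'k \<Rightarrow> 'k \<Rightarrow> 'k" by unfold_locales (auto simp: algebra_simps)
      interpret vector_space_pair "Scale C" "(*) :: 'k \<Rightarrow> 'k \<Rightarrow> 'k" ..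
      \<comment> \<open>A functional with value 1 at \<open>v\<close> is built on the whole ambient
        space and then cut off outside \<open>?V\<close>, as \<open>dual_space\<close>
        demands.\<close>
      have "vs.independent {v}" using v(2) by simp
      then obtain g where g: "Vector_Spaces.linear (Scale C) (*) g" "g v = 1"
        using linear_independent_extend[of "{v}" "\<lambda>_. 1"] by auto
      define \<alpha> where "\<alpha> = (\<lambda>w. if w \<in> ?V then g w else 0)"
      have "\<alpha> \<in> ?D" unfolding dual_space_def linear_on_def \<alpha>_def
        using linear_add[OF g(1)] linear_scale[OF g(1)] add_in_Hom
          vs.subspace_scale[OF subspace_Hom[of Y "Shift_n C d X"]] by auto
      then have "\<alpha> v = 0" using D by metis
      then show False using g(2) v(1) by (simp add: \<alpha>_def)
    qed
  qed
qed

lemma Hom_zero_direct_sum_right: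
  assumes "is_direct_sum C J M X" "\<And>j. j \<in> J \<Longrightarrow> Hom C W (M j) = {0}"
  shows "Hom C W X = {0}"
  using assms
proof (induction rule: is_direct_sum_induct)
  case (zero Z) then show ?case using Hom_zero_zero_object by blast
next
  case (extension X Y Z f g h) then show ?case using Hom_zero_triangle_right by blast
qed auto

lemma star_shifts_mono:
  assumes "subcategory C S" "m \<le> n" shows "star_shifts C S m \<subseteq> star_shifts C S n"
  using assms(2) by (induction rule: dec_induct) (use star_shifts_mono_Suc[OF assms(1)] in auto)

text \<open>Serves to show that a nonzero component meets the cluster tilting subcategory in a
  nonzero object.\<close>

lemma star_shifts_zero_object:
  assumes "X \<in> star_shifts C S n" "\<And>A. A \<in> S \<Longrightarrow> zero_object C A"
  shows "zero_object C X"
  using assms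
proof (induction rule: star_shifts_induct)
  case (shift A s)
  then show ?case by (simp add: zero_object_iff_Hom Hom_Shift_n_zero_iff)
next
  case (isomorphic X Y)
  then show ?case using Hom_zero_isomorphic[of X X Y Y] by (simp add: zero_object_iff_Hom)
next
  case (extension X Y Z f g h)
  then have "Hom C X Z = {0}" "Hom C Y Z = {0}" by (auto simp: zero_object_def)
  then show ?case using Hom_zero_triangle_left[OF extension.hyps] by (simp add: zero_object_iff_Hom)
qed

section \<open>Cluster tilting subcategories\<close>

lemma cluster_tilting_inD:
  assumes "cluster_tilting_in C d U T"
  shows "subcategory C T" "T \<subseteq> U"
    "X \<in> T \<Longrightarrow> Y \<in> T \<Longrightarrow> 1 \<le> j \<Longrightarrow> j \<le> d - 1 \<Longrightarrow> Hom C X (Shift_n C j Y) = {0}"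
    "X \<in> U \<Longrightarrow> (\<And>j Y. 1 \<le> j \<Longrightarrow> j \<le> d - 1 \<Longrightarrow> Y \<in> T \<Longrightarrow> Hom C Y (Shift_n C j X) = {0}) \<Longrightarrow> X \<in> T"
    "X \<in> U \<Longrightarrow> (\<And>j Y. 1 \<le> j \<Longrightarrow> j \<le> d - 1 \<Longrightarrow> Y \<in> T \<Longrightarrow> Hom C X (Shift_n C j Y) = {0}) \<Longrightarrow> X \<in> T"
    "contravariantly_finite C U T" "covariantly_finite C U T"
  using assms unfolding cluster_tilting_in_def Ext_def by (auto 0 3)

text \<open>In the induction step for \<open>X' = X[-n-1]\<close>, let \<open>W\<close> be the cocone of a left \<open>T\<close>-approximation of \<open>X'\<close>.
  Then \<open>Hom(W[n+1], T[n+1])\<close> vanishes in addition to what is known for \<open>X\<close>, because a map from \<open>W\<close> to \<open>T\<close>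
  extends to \<open>X'\<close> and hence factors through the approximation.\<close>

lemma cluster_tilting_star_shifts:
  assumes U: "triangulated_subcategory C U" and T: "cluster_tilting_in C d U T"
    and "n \<le> d - 1" "X \<in> U"
    and "\<And>j Y. Y \<in> T \<Longrightarrow> n < j \<Longrightarrow> j \<le> d - 1 \<Longrightarrow> Hom C X (Shift_n C j Y) = {0}"
  shows "X \<in> star_shifts C T n"
  using assms(3-)
proof (induction n arbitrary: X)
  case 0
  then show ?case using cluster_tilting_inD(5)[OF T] by simp
next
  case (Suc n)
  \<comment> \<open>Approximating the desuspension makes the approximating object reappear as
    A[n+1], the last factor of the product.\<close>
  obtain X' where X': "isomorphic C (Shift_n C (Suc n) X') X" using Shift_n_desuspend by blast
  have "Shift_n C (Suc n) X' \<in> U"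
    using subcategory_isomorphic[OF triangulated_subcategoryD(1)[OF U] Suc.prems(2) isomorphic_sym[OF X']] .
  then have X'U: "X' \<in> U" by (rule triangulated_subcategory_unshift[OF U])
  obtain A f where A: "A \<in> T" "f \<in> Hom C X' A"
    "\<And>Y g. Y \<in> T \<Longrightarrow> g \<in> Hom C X' Y \<Longrightarrow> \<exists>h \<in> Hom C A Y. g = h \<cdot> f"
    using cluster_tilting_inD(7)[OF T] X'U unfolding covariantly_finite_def by meson
  obtain W k h where W: "Triangle C W X' A k f h" using ex_cocone[OF A(2)] by blast
  have k: "k \<in> Hom C W X'" and h: "h \<in> Hom C A (Shift C W)" using Triangle_in_Hom[OF W] by auto
  have R: "Triangle C A (Shift C W) (Shift C X') h (- Shift_map C k) (- Shift_map C f)"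
    using rotate[OF rotate[OF W]] .
  have WU: "W \<in> U" using triangulated_subcategory_cocone[OF U W X'U] A(1) cluster_tilting_inD(2)[OF T] by blast
  have zero: "Hom C W Y = {0}" if Y: "Y \<in> T" for Y
  proof (rule Hom_eq_zeroI)
    fix u assume u: "u \<in> Hom C W Y"
    have su: "Shift_map C u \<in> Hom C (Shift C W) (Shift C Y)" using Shift_map_in_Hom[OF u] .
    have "Hom C A (Shift C Y) = {0}" using cluster_tilting_inD(3)[OF T A(1) Y, of 1] Suc.prems(1) by simp
    then have "Shift_map C u \<cdot> h = 0" using Comp_in_Hom[OF h su] by auto
    then obtain v where v: "v \<in> Hom C (Shift C X') (Shift C Y)" "v \<cdot> (- Shift_map C k) = Shift_map C u"
      using exact_right[OF R su] by blast
    obtain w where w: "w \<in> Hom C X' Y" "Shift_map C w = v" using v(1) by (rule Shift_map_surj)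
    obtain e where e: "e \<in> Hom C A Y" "w = e \<cdot> f" using A(3)[OF Y w(1)] by blast
    have "w \<cdot> k = 0"
      using e(2) Comp_assoc[OF k A(2) e(1)] triangle_comp_zero[OF W] Comp_zero_right[OF e(1)] by simp
    then have "v \<cdot> Shift_map C k = 0" using Shift_map_Comp[OF k w(1)] w(2) Shift_map_zero by simp
    then have "Shift_map C u = Shift_map C 0"
      using v(2) Comp_neg_right[OF Shift_map_in_Hom[OF k] v(1)] Shift_map_zero by simp
    then show "u = 0" using Shift_map_inject[OF u zero_in_Hom] by blast
  qed
  have "Shift_n C (Suc n) W \<in> star_shifts C T n"
  proof (rule Suc.IH)
    show "Shift_n C (Suc n) W \<in> U" using triangulated_subcategory_Shift_n[OF U WU] .
    fix j Y assume Y: "Y \<in> T" and j: "n < j" "j \<le> d - 1"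
    have "Hom C W (Shift_n C (j - Suc n) Y) = {0}"
    proof (cases "j = Suc n")
      case True then show ?thesis using zero[OF Y] by simp
    next
      case False
      define m where "m = j - Suc n"
      have m: "1 \<le> m" "Suc m \<le> d - 1" "Suc n + m = j" using False j by (auto simp: m_def)
      have "Hom C X (Shift_n C j Y) = {0}" using Suc.prems(3)[OF Y] False j by simp
      then have "Hom C (Shift_n C (Suc n) X') (Shift_n C (Suc n + m) Y) = {0}"
        unfolding m(3) by (rule Hom_zero_isomorphic[OF _ isomorphic_sym[OF X'] isomorphic_refl])
      then have "Hom C X' (Shift_n C m Y) = {0}"
        unfolding Shift_n_add by (simp only: Hom_Shift_n_zero_iff)
      then have "Hom C (Shift C X') (Shift C (Shift_n C m Y)) = {0}" by (simp only: Hom_Shift_zero_iff)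
      moreover have "Hom C A (Shift C (Shift_n C m Y)) = {0}"
        using cluster_tilting_inD(3)[OF T A(1) Y, of "Suc m"] m by simp
      ultimately have "Hom C (Shift C W) (Shift C (Shift_n C m Y)) = {0}" 
        using Hom_zero_triangle_left[OF R] by blast
      then show ?thesis by (simp only: Hom_Shift_zero_iff m_def)
    qed
    then show "Hom C (Shift_n C (Suc n) W) (Shift_n C j Y) = {0}"
      using Hom_Shift_n_diff_right[of "Suc n" j W Y] j by simp
  qed (use Suc.prems(1) in simp)
  moreover obtain a b c where "Triangle C (Shift_n C (Suc n) W) X (Shift_n C (Suc n) A) a b c"
    using triangle_Shift_n[OF W, of "Suc n"] triangle_isomorphic[OF _ isomorphic_refl X' isomorphic_refl]
    by blast
  moreover have "Shift_n C (Suc n) A \<in> shift_set C (Suc n) T"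
    using A(1) isomorphic_refl unfolding shift_set_def by blast
  ultimately show ?case unfolding star_shifts.simps star_def by blast
qed

lemma cluster_tilting_eq_star_shifts:
  assumes "triangulated_subcategory C U" "cluster_tilting_in C d U T"
  shows "U = star_shifts C T (d - 1)"
proof
  \<comment> \<open>For n = d - 1 no index j is left in the Hom condition.\<close>
  show "U \<subseteq> star_shifts C T (d - 1)"
    by (rule subsetI, rule cluster_tilting_star_shifts[OF assms]) simp_all
  show "star_shifts C T (d - 1) \<subseteq> U"
    using star_shifts_subset[OF assms(1) cluster_tilting_inD(2)[OF assms(2)]] .
qed

section \<open>Decompositions of the triangulated category\<close>

lemma tri_direct_sumD:
  assumes "tri_direct_sum C U I Cs"
  shows "i \<in> I \<Longrightarrow> triangulated_subcategory C (Cs i)" "i \<in> I \<Longrightarrow> Cs i \<subseteq> U"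
    "i \<in> I \<Longrightarrow> j \<in> I \<Longrightarrow> i \<noteq> j \<Longrightarrow> X \<in> Cs i \<Longrightarrow> Y \<in> Cs j \<Longrightarrow> Hom C X Y = {0}"
    "sums_of_components C U I Cs"
  using assms unfolding tri_direct_sum_def by simp_all

lemma sums_of_components_Int:
  assumes "sums_of_components C U I Cs" "subcategory C T" "T \<subseteq> U" "X \<in> T"
  shows "\<exists>J M. J \<subseteq> I \<and> is_direct_sum C J M X \<and> (\<forall>j\<in>J. M j \<in> T \<inter> Cs j)"
proof -
  obtain J M where J: "J \<subseteq> I" "\<forall>j\<in>J. M j \<in> Cs j" "is_direct_sum C J M X"
    using bspec[OF assms(1)[unfolded sums_of_components_def] subsetD[OF assms(3,4)]] by (elim exE conjE)
  have "M j \<in> T" if "j \<in> J" for j using subcategory_summand[OF assms(2,4) J(3) that] .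
  then show ?thesis using J by (intro exI[of _ J] exI[of _ M]) simp
qed

text \<open>An approximation will be cut down to its summand at \<open>i\<close>, so this index has
  to occur; a zero object is inserted if necessary.\<close>

lemma sums_of_components_Int_at:
  assumes "sums_of_components C U I Cs" "subcategory C T" "T \<subseteq> U" "X \<in> T" "i \<in> I"
    "\<And>i. i \<in> I \<Longrightarrow> subcategory C (Cs i)"
  shows "\<exists>J M. J \<subseteq> I \<and> i \<in> J \<and> is_direct_sum C J M X \<and> (\<forall>j\<in>J. M j \<in> T \<inter> Cs j)"
proof -
  obtain J M where J: "J \<subseteq> I" "is_direct_sum C J M X" "\<forall>j\<in>J. M j \<in> T \<inter> Cs j"
    using sums_of_components_Int[OF assms(1-4)] by blast
  have Z: "\<exists>Z\<in>T \<inter> Cs i. zero_object C Z"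
    using subcategory_zero[OF subcategory_Int[OF assms(2) assms(6)[OF assms(5)]]] .
  have "\<exists>N. is_direct_sum C (J \<union> {i}) N X \<and> (\<forall>j\<in>J \<union> {i}. N j \<in> T \<inter> Cs j)"
  proof (rule is_direct_sum_enlarge[OF _ J(2)])
    show "\<exists>Z\<in>T \<inter> Cs k. zero_object C Z" if "k \<in> {i}" for k using Z that by blast
    show "M j \<in> T \<inter> Cs j" if "j \<in> J" for j using J(3) that by blast
  qed simp
  then obtain N where N: "is_direct_sum C (J \<union> {i}) N X" "\<forall>j\<in>J \<union> {i}. N j \<in> T \<inter> Cs j"
    by (elim exE conjE)
  have "J \<union> {i} \<subseteq> I" "i \<in> J \<union> {i}" using J(1) assms(5) by simp_all
  from this N show ?thesis by (intro exI[of _ "J \<union> {i}"] exI[of _ N] conjI)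
qed

text \<open>Summands of objects of \<open>T\<close> stay in \<open>T\<close>, and since the
  components are closed under shift, condition (3) is again their Hom-orthogonality.\<close>

lemma ct_direct_sum_of_tri_direct_sum:
  assumes T: "cluster_tilting_in C d U T" and D: "tri_direct_sum C U I Cs"
  shows "ct_direct_sum C d T I (\<lambda>i. T \<inter> Cs i)"
  unfolding ct_direct_sum_def
proof (intro conjI ballI impI)
  note S = cluster_tilting_inD(1,2)[OF T]
  show "subcategory C (T \<inter> Cs i)" if "i \<in> I" for i
    using subcategory_Int[OF S(1) triangulated_subcategoryD(1)[OF tri_direct_sumD(1)[OF D that]]] .
  show "sums_of_components C T I (\<lambda>i. T \<inter> Cs i)"
    unfolding sums_of_components_def
  proof
    fix X assume X: "X \<in> T"
    obtain J M where "J \<subseteq> I" "is_direct_sum C J M X" "\<forall>j\<in>J. M j \<in> T \<inter> Cs j"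
      using sums_of_components_Int[OF tri_direct_sumD(4)[OF D] S X] by blast
    then show "\<exists>J M. J \<subseteq> I \<and> (\<forall>i\<in>J. M i \<in> T \<inter> Cs i) \<and> is_direct_sum C J M X" by blast
  qed
  show "Hom C X Y = {0}" if "i \<in> I" "j \<in> I" "i \<noteq> j" "X \<in> T \<inter> Cs i" "Y \<in> T \<inter> Cs j" for i j X Y
    using tri_direct_sumD(3)[OF D that(1-3)] that(4,5) by blast
  show "Hom C (Shift_n C t X) Y = {0}"
    if "i \<in> I" "j \<in> I" "i \<noteq> j" "X \<in> T \<inter> Cs i" "Y \<in> T \<inter> Cs j" for i j t X Y
    using tri_direct_sumD(3)[OF D that(1-3)] that(4,5)
      triangulated_subcategory_Shift_n[OF tri_direct_sumD(1)[OF D that(1)], of X t] by blast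
qed auto

text \<open>An object of \<open>Cs i\<close> sees only the summand at \<open>i\<close> of an object
  of \<open>T\<close>, also after shifting. Testing Ext against \<open>T \<inter> Cs i\<close>
  therefore amounts to testing against \<open>T\<close>, and a \<open>T\<close>-approximation
  remains one when the other summands are dropped.\<close>

lemma cluster_tilting_in_component:
  assumes T: "cluster_tilting_in C d U T" and D: "tri_direct_sum C U I Cs" and i: "i \<in> I"
  shows "cluster_tilting_in C d (Cs i) (T \<inter> Cs i)"
proof -
  note S = cluster_tilting_inD(1,2)[OF T]
  have Ci: "triangulated_subcategory C (Cs i)" "Cs i \<subseteq> U" using tri_direct_sumD(1,2)[OF D i] .
  have sub: "\<And>i. i \<in> I \<Longrightarrow> subcategory C (Cs i)"
    by (rule triangulated_subcategoryD(1)[OF tri_direct_sumD(1)[OF D]])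
  note at = sums_of_components_Int_at[OF tri_direct_sumD(4)[OF D] S _ i sub]
  have ext: "Hom C X (Shift_n C j Y) = {0}" if "X \<in> T" "Y \<in> T" "1 \<le> j" "j \<le> d - 1" for X Y j
    using cluster_tilting_inD(3)[OF T that] .
  have left: "Hom C Y (Shift_n C n X) = {0}"
    if X: "X \<in> Cs i" and Y: "Y \<in> T" and h: "\<And>Y. Y \<in> T \<inter> Cs i \<Longrightarrow> Hom C Y (Shift_n C n X) = {0}" for X Y n
  proof -
    obtain J M where J: "J \<subseteq> I" "is_direct_sum C J M Y" "\<forall>j\<in>J. M j \<in> T \<inter> Cs j"
      using sums_of_components_Int[OF tri_direct_sumD(4)[OF D] S Y] by blast
    show ?thesis
    proof (rule Hom_zero_direct_sum_left[OF J(2)])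
      fix j assume "j \<in> J"
      then show "Hom C (M j) (Shift_n C n X) = {0}"
        using h tri_direct_sumD(3)[OF D _ i] J(1,3) triangulated_subcategory_Shift_n[OF Ci(1) X]
        by (cases "j = i") blast+
    qed
  qed
  have right: "Hom C X (Shift_n C n Y) = {0}"
    if X: "X \<in> Cs i" and Y: "Y \<in> T" and h: "\<And>Y. Y \<in> T \<inter> Cs i \<Longrightarrow> Hom C X (Shift_n C n Y) = {0}" for X Y n
  proof -
    obtain J M where J: "J \<subseteq> I" "is_direct_sum C J M Y" "\<forall>j\<in>J. M j \<in> T \<inter> Cs j"
      using sums_of_components_Int[OF tri_direct_sumD(4)[OF D] S Y] by blast
    show ?thesis
    proof (rule Hom_zero_direct_sum_right[OF is_direct_sum_Shift_n[OF J(2)]])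
      fix j assume j: "j \<in> J"
      then have "Shift_n C n (M j) \<in> Cs j"
        using triangulated_subcategory_Shift_n tri_direct_sumD(1)[OF D] J(1,3) by blast
      then show "Hom C X (Shift_n C n (M j)) = {0}"
        using j h tri_direct_sumD(3)[OF D i] J(1,3) X by (cases "j = i") blast+
    qed
  qed
  have contra: "contravariantly_finite C (Cs i) (T \<inter> Cs i)"
    unfolding contravariantly_finite_def
  proof
    fix X assume X: "X \<in> Cs i"
    obtain A f where A: "A \<in> T" "f \<in> Hom C A X"
      "\<And>Y g. Y \<in> T \<Longrightarrow> g \<in> Hom C Y X \<Longrightarrow> \<exists>h \<in> Hom C Y A. g = f \<cdot> h"
      using cluster_tilting_inD(6)[OF T] X Ci(2) unfolding contravariantly_finite_def by (meson subsetD)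
    obtain J M where J: "J \<subseteq> I" "i \<in> J" "is_direct_sum C J M A" "\<forall>j\<in>J. M j \<in> T \<inter> Cs j"
      using at[OF A(1)] by blast
    obtain inc pr where P: "finite J" "\<And>j. j \<in> J \<Longrightarrow> inc j \<in> Hom C (M j) A"
      "\<And>j. j \<in> J \<Longrightarrow> pr j \<in> Hom C A (M j)" "(\<Sum>j\<in>J. inc j \<cdot> pr j) = Idn C A"
      using is_direct_sumE[OF J(3)] by metis
    have "Hom C (M j) X = {0}" if "j \<in> J" "j \<noteq> i" for j
      using tri_direct_sumD(3)[OF D _ i that(2)] J(1,4) that(1) X by blast
    then have e: "(f \<cdot> inc i) \<cdot> pr i = f"
      using direct_sum_factor_left[where inc = inc and pr = pr, OF P J(2) A(2)] by blast
    have fi: "f \<cdot> inc i \<in> Hom C (M i) X" using Comp_in_Hom[OF P(2)[OF J(2)] A(2)] .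
    have "\<exists>h\<in>Hom C Y (M i). g = (f \<cdot> inc i) \<cdot> h" if Yg: "Y \<in> T" "g \<in> Hom C Y X" for Y g
    proof -
      obtain h where h: "h \<in> Hom C Y A" "g = f \<cdot> h" using A(3)[OF Yg] by blast
      have "(f \<cdot> inc i) \<cdot> (pr i \<cdot> h) = g" using Comp_assoc[OF h(1) P(3)[OF J(2)] fi] e h(2) by simp
      then show ?thesis using Comp_in_Hom[OF h(1) P(3)[OF J(2)]] by blast
    qed
    then show "\<exists>A\<in>T \<inter> Cs i. \<exists>f\<in>Hom C A X. \<forall>Y\<in>T \<inter> Cs i. \<forall>g\<in>Hom C Y X. \<exists>h\<in>Hom C Y A. g = f \<cdot> h"
      using fi bspec[OF J(4) J(2)] by blast
  qed
  have co: "covariantly_finite C (Cs i) (T \<inter> Cs i)"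
    unfolding covariantly_finite_def
  proof
    fix X assume X: "X \<in> Cs i"
    obtain A f where A: "A \<in> T" "f \<in> Hom C X A"
      "\<And>Y g. Y \<in> T \<Longrightarrow> g \<in> Hom C X Y \<Longrightarrow> \<exists>h \<in> Hom C A Y. g = h \<cdot> f"
      using cluster_tilting_inD(7)[OF T] X Ci(2) unfolding covariantly_finite_def by (meson subsetD)
    obtain J M where J: "J \<subseteq> I" "i \<in> J" "is_direct_sum C J M A" "\<forall>j\<in>J. M j \<in> T \<inter> Cs j"
      using at[OF A(1)] by blast
    obtain inc pr where P: "finite J" "\<And>j. j \<in> J \<Longrightarrow> inc j \<in> Hom C (M j) A"
      "\<And>j. j \<in> J \<Longrightarrow> pr j \<in> Hom C A (M j)" "(\<Sum>j\<in>J. inc j \<cdot> pr j) = Idn C A"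
      using is_direct_sumE[OF J(3)] by metis
    have "Hom C X (M j) = {0}" if "j \<in> J" "j \<noteq> i" for j
      using tri_direct_sumD(3)[OF D i _ that(2)[symmetric]] J(1,4) that(1) X by blast
    then have e: "inc i \<cdot> (pr i \<cdot> f) = f"
      using direct_sum_factor_right[where inc = inc and pr = pr, OF P J(2) A(2)] by blast
    have pf: "pr i \<cdot> f \<in> Hom C X (M i)" using Comp_in_Hom[OF A(2) P(3)[OF J(2)]] .
    have "\<exists>h\<in>Hom C (M i) Y. g = h \<cdot> (pr i \<cdot> f)" if Yg: "Y \<in> T" "g \<in> Hom C X Y" for Y g
    proof -
      obtain h where h: "h \<in> Hom C A Y" "g = h \<cdot> f" using A(3)[OF Yg] by blast
      have "(h \<cdot> inc i) \<cdot> (pr i \<cdot> f) = g" using Comp_assoc[OF pf P(2)[OF J(2)] h(1)] e h(2) by simp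
      then show ?thesis using Comp_in_Hom[OF P(2)[OF J(2)] h(1)] by blast
    qed
    then show "\<exists>A\<in>T \<inter> Cs i. \<exists>f\<in>Hom C X A. \<forall>Y\<in>T \<inter> Cs i. \<forall>g\<in>Hom C X Y. \<exists>h\<in>Hom C A Y. g = h \<cdot> f"
      using pf bspec[OF J(4) J(2)] by blast
  qed
  show ?thesis unfolding cluster_tilting_in_def Ext_def
  proof (intro conjI ballI contra co)
    show "subcategory C (T \<inter> Cs i)" using subcategory_Int[OF S(1) sub[OF i]] .
    show "Hom C X (Shift_n C n Y) = {0}" if "n \<in> {1..d - 1}" "X \<in> T \<inter> Cs i" "Y \<in> T \<inter> Cs i" for n X Y
      using ext that by auto
    fix X assume X: "X \<in> Cs i"
    show "X \<in> T \<inter> Cs i \<longleftrightarrow> (\<forall>n\<in>{1..d - 1}. \<forall>Y\<in>T \<inter> Cs i. Hom C Y (Shift_n C n X) = {0})"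
    proof
      assume "X \<in> T \<inter> Cs i"
      then show "\<forall>n\<in>{1..d - 1}. \<forall>Y\<in>T \<inter> Cs i. Hom C Y (Shift_n C n X) = {0}" using ext by auto
    next
      assume "\<forall>n\<in>{1..d - 1}. \<forall>Y\<in>T \<inter> Cs i. Hom C Y (Shift_n C n X) = {0}"
      then have "X \<in> T"
        using cluster_tilting_inD(4)[OF T] X Ci(2) left[OF X] by (meson atLeastAtMost_iff subsetD)
      then show "X \<in> T \<inter> Cs i" using X by blast
    qed
    show "X \<in> T \<inter> Cs i \<longleftrightarrow> (\<forall>n\<in>{1..d - 1}. \<forall>Y\<in>T \<inter> Cs i. Hom C X (Shift_n C n Y) = {0})"
    proof
      assume "X \<in> T \<inter> Cs i"
      then show "\<forall>n\<in>{1..d - 1}. \<forall>Y\<in>T \<inter> Cs i. Hom C X (Shift_n C n Y) = {0}" using ext by auto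
    next
      assume "\<forall>n\<in>{1..d - 1}. \<forall>Y\<in>T \<inter> Cs i. Hom C X (Shift_n C n Y) = {0}"
      then have "X \<in> T"
        using cluster_tilting_inD(5)[OF T] X Ci(2) right[OF X] by (meson atLeastAtMost_iff subsetD)
      then show "X \<in> T \<inter> Cs i" using X by blast
    qed
  qed blast
qed

section \<open>Decompositions of the cluster tilting subcategory\<close>

lemma ct_direct_sumD:
  assumes "ct_direct_sum C d T I Ts"
  shows "i \<in> I \<Longrightarrow> subcategory C (Ts i)" "i \<in> I \<Longrightarrow> Ts i \<subseteq> T"
    "i \<in> I \<Longrightarrow> j \<in> I \<Longrightarrow> i \<noteq> j \<Longrightarrow> t \<le> d - 2 \<Longrightarrow> X \<in> Ts i \<Longrightarrow> Y \<in> Ts j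
      \<Longrightarrow> Hom C (Shift_n C t X) Y = {0}"
    "sums_of_components C T I Ts"
proof -
  show "i \<in> I \<Longrightarrow> j \<in> I \<Longrightarrow> i \<noteq> j \<Longrightarrow> t \<le> d - 2 \<Longrightarrow> X \<in> Ts i \<Longrightarrow> Y \<in> Ts j
      \<Longrightarrow> Hom C (Shift_n C t X) Y = {0}"
    using assms unfolding ct_direct_sum_def by (cases "t = 0") simp_all
qed (use assms in \<open>simp_all add: ct_direct_sum_def\<close>)

end

text \<open>The ambient \<open>U\<close> is the whole category when \<open>T\<close> is decomposed,
  and a single component when a two-term splitting of its cluster tilting subcategory has to be
  refuted. The duality is always that of the whole category.\<close>

locale decomposed_cluster_tilting = triangulated_category C
  for C :: "('o, 'm::ab_group_add, 'k::field) tri_cat" (structure) +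
  fixes d :: nat and U T :: "'o set" and I :: "'i set" and Ts :: "'i \<Rightarrow> 'o set"
  assumes d: "d > 1" and CY: "calabi_yau C d" and U: "triangulated_subcategory C U"
    and T: "cluster_tilting_in C d U T" and D: "ct_direct_sum C d T I Ts"
begin

abbreviation component :: "'i \<Rightarrow> 'o set" where
  "component i \<equiv> star_shifts C (Ts i) (d - 1)"

section \<open>Orthogonality that follows from the hypotheses\<close>

text \<open>The shift d is dual to the shift 0 with \<open>i\<close> and \<open>j\<close> exchanged;
  in between, this is Ext-vanishing inside \<open>T\<close>.\<close>

lemma Hom_components_nonneg:
  assumes ij: "i \<in> I" "j \<in> I" "i \<noteq> j" and XY: "X \<in> Ts i" "Y \<in> Ts j" and t: "t \<le> d"
  shows "Hom C X (Shift_n C t Y) = {0}"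
proof -
  have XYT: "X \<in> T" "Y \<in> T" using ct_direct_sumD(2)[OF D] ij XY by auto
  consider "t = 0" | "1 \<le> t" "t \<le> d - 1" | "t = d" using t by linarith
  then show ?thesis
  proof cases
    case 1 then show ?thesis using ct_direct_sumD(3)[OF D ij _ XY, of 0] by simp
  next
    case 2 then show ?thesis using cluster_tilting_inD(3)[OF T XYT] by blast
  next
    case 3
    have "Hom C Y X = {0}" using ct_direct_sumD(3)[OF D ij(2,1) ij(3)[symmetric] _ XY(2,1), of 0] by simp
    then show ?thesis using calabi_yau_Hom_zero_iff[OF CY, of Y X] 3 by simp
  qed
qed

lemma Hom_components_shifts:
  assumes ij: "i \<in> I" "j \<in> I" "i \<noteq> j" and XY: "X \<in> Ts i" "Y \<in> Ts j" and st: "t \<le> s + d" "s \<le> t + (d - 2)"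
  shows "Hom C (Shift_n C s X) (Shift_n C t Y) = {0}"
proof (cases "s \<le> t")
  case True
  then show ?thesis using Hom_Shift_n_diff_right[of s t X Y] Hom_components_nonneg[OF ij XY, of "t - s"] st by simp
next
  case False
  then show ?thesis
    using Hom_Shift_n_diff_left[of t s X Y] ct_direct_sumD(3)[OF D ij _ XY, of "s - t"] st by simp
qed

text \<open>The extra shift raises the smallest difference from -(d - 1) to -(d - 2), just inside
  the range of \<open>Hom_components_shifts\<close>; the largest becomes d, its upper end.\<close>

lemma Ext1_components:
  assumes ij: "i \<in> I" "j \<in> I" "i \<noteq> j" and XY: "X \<in> component i" "Y \<in> component j"
  shows "Hom C X (Shift C Y) = {0}"
proof -
  have "Hom C (Shift_n C 0 X) (Shift_n C 1 Y) = {0}"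
    by (rule Hom_zero_star_shifts[OF XY], rule Hom_components_shifts[OF ij]) (use d in simp_all)
  then show ?thesis by simp
qed

lemma component_subset: "i \<in> I \<Longrightarrow> component i \<subseteq> U"
  using star_shifts_subset[OF U] ct_direct_sumD(2)[OF D] cluster_tilting_inD(2)[OF T] by (meson subset_trans)

lemma component_zero: "i \<in> I \<Longrightarrow> \<exists>Z\<in>star_shifts C (Ts i) n. zero_object C Z"
  using subset_star_shifts[OF ct_direct_sumD(1)[OF D]] subcategory_zero[OF ct_direct_sumD(1)[OF D]]
  by (meson subsetD)

section \<open>Splitting of objects into components\<close>

text \<open>In the star product the first factor splits by induction and the last by the
  decomposition of \<open>T\<close>; Ext^1-orthogonality carries the splitting over to the
  extension.\<close>

lemma star_shifts_decompose:
  assumes "n \<le> d - 1" "X \<in> star_shifts C T n"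
  shows "\<exists>J P. J \<subseteq> I \<and> is_direct_sum C J P X \<and> (\<forall>j\<in>J. P j \<in> star_shifts C (Ts j) n)"
  using assms
proof (induction n arbitrary: X)
  case 0
  have "X \<in> T" using 0 by simp
  from bspec[OF ct_direct_sumD(4)[OF D, unfolded sums_of_components_def] this]
  obtain J M where "J \<subseteq> I" "\<forall>j\<in>J. M j \<in> Ts j" "is_direct_sum C J M X" by (elim exE conjE)
  then show ?case by (intro exI[of _ J] exI[of _ M]) simp
next
  case (Suc n)
  obtain X' Y A f g h where X': "X' \<in> star_shifts C T n" and A: "A \<in> T"
    and iso: "isomorphic C Y (Shift_n C (Suc n) A)" and tri: "Triangle C X' X Y f g h"
    using Suc.prems(2) unfolding star_shifts.simps star_def shift_set_def by blast
  obtain f g h where tri: "Triangle C X' X (Shift_n C (Suc n) A) f g h"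
    using triangle_isomorphic[OF tri isomorphic_refl isomorphic_refl iso] by blast
  have n: "n \<le> d - 1" using Suc.prems(1) by simp
  from Suc.IH[OF n X'] obtain J1 M1 where M1: "J1 \<subseteq> I" "is_direct_sum C J1 M1 X'"
    "\<forall>j\<in>J1. M1 j \<in> star_shifts C (Ts j) n" by (elim exE conjE)
  from bspec[OF ct_direct_sumD(4)[OF D, unfolded sums_of_components_def] A]
  obtain J2 N2 where N2: "J2 \<subseteq> I" "\<forall>j\<in>J2. N2 j \<in> Ts j" "is_direct_sum C J2 N2 A" by (elim exE conjE)
  \<comment> \<open>\<open>extension_of_direct_sums\<close> wants one index set for both outer
    terms, so both sums are padded to the union.\<close>
  define J where "J = J1 \<union> J2"
  have J: "J \<subseteq> I" "finite J1" "finite J2" using M1 N2 by (auto simp: J_def is_direct_sum_def)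
  have "\<exists>M. is_direct_sum C (J1 \<union> J2) M X' \<and> (\<forall>j\<in>J1 \<union> J2. M j \<in> star_shifts C (Ts j) n)"
    by (rule is_direct_sum_enlarge[OF J(3) M1(2)]) (use component_zero N2(1) M1(3) in auto)
  then obtain M where M: "is_direct_sum C J M X'" "\<forall>j\<in>J. M j \<in> star_shifts C (Ts j) n"
    unfolding J_def by (elim exE conjE)
  have "\<exists>N. is_direct_sum C (J2 \<union> J1) N A \<and> (\<forall>j\<in>J2 \<union> J1. N j \<in> Ts j)"
    by (rule is_direct_sum_enlarge[OF J(2) N2(3)])
      (use subcategory_zero[OF ct_direct_sumD(1)[OF D]] M1(1) N2(2) in auto)
  then obtain N where N: "is_direct_sum C J N A" "\<forall>j\<in>J. N j \<in> Ts j"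
    unfolding J_def Un_commute[of J2] by (elim exE conjE)
  \<comment> \<open>Both outer terms are viewed inside component j, so that
    \<open>Ext1_components\<close> yields all four orthogonality conditions.\<close>
  have MC: "M j \<in> component j" and NC: "Shift_n C (Suc n) (N j) \<in> component j" if "j \<in> J" for j
  proof -
    have S: "subcategory C (Ts j)" using ct_direct_sumD(1)[OF D] J(1) that by blast
    show "M j \<in> component j" using star_shifts_mono[OF S n] M(2) that by blast
    show "Shift_n C (Suc n) (N j) \<in> component j"
      using star_shifts_mono[OF S Suc.prems(1)] Shift_n_in_star_shifts[OF S, of "N j" "Suc n"] N(2) that by blast
  qed
  have "\<exists>P. is_direct_sum C J P X \<and>
    (\<forall>j\<in>J. \<exists>a b c. Triangle C (M j) (P j) (Shift_n C (Suc n) (N j)) a b c)"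
  proof (rule extension_of_direct_sums[OF _ M(1) is_direct_sum_Shift_n[OF N(1)] tri])
    show "finite J" using J(2,3) by (simp add: J_def)
    fix i j assume ij: "i \<in> J" "j \<in> J" "i \<noteq> j"
    then have I: "i \<in> I" "j \<in> I" using J(1) by auto
    note E = Ext1_components[OF I ij(3)]
    show "Hom C (M i) (Shift C (M j)) = {0} \<and> Hom C (M i) (Shift C (Shift_n C (Suc n) (N j))) = {0} \<and>
      Hom C (Shift_n C (Suc n) (N i)) (Shift C (M j)) = {0} \<and>
      Hom C (Shift_n C (Suc n) (N i)) (Shift C (Shift_n C (Suc n) (N j))) = {0}"
      using E[OF MC[OF ij(1)] MC[OF ij(2)]] E[OF MC[OF ij(1)] NC[OF ij(2)]]
        E[OF NC[OF ij(1)] MC[OF ij(2)]] E[OF NC[OF ij(1)] NC[OF ij(2)]] by (intro conjI)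
  qed
  then obtain P where P: "is_direct_sum C J P X"
    "\<forall>j\<in>J. \<exists>a b c. Triangle C (M j) (P j) (Shift_n C (Suc n) (N j)) a b c" by (elim exE conjE)
  have "P j \<in> star_shifts C (Ts j) (Suc n)" if j: "j \<in> J" for j
  proof -
    obtain a b c where "Triangle C (M j) (P j) (Shift_n C (Suc n) (N j)) a b c" using P(2) j by blast
    moreover have "Shift_n C (Suc n) (N j) \<in> shift_set C (Suc n) (Ts j)"
      using N(2) j isomorphic_refl unfolding shift_set_def by blast
    ultimately show ?thesis using M(2) j unfolding star_shifts.simps star_def by blast
  qed
  then show ?case using J(1) P(1) by (intro exI[of _ J] exI[of _ P]) simp
qed

lemma components_decompose:
  assumes "X \<in> U"
  shows "\<exists>J P. J \<subseteq> I \<and> is_direct_sum C J P X \<and> (\<forall>j\<in>J. P j \<in> component j)"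
  using star_shifts_decompose[of "d - 1" X] cluster_tilting_eq_star_shifts[OF U T] assms by simp

text \<open>The summands of \<open>X\<close> in other components receive only zero maps, so
  \<open>X\<close> is isomorphic to its summand at \<open>i\<close>. Closure properties, which are
  hard to see on iterated extensions, can thus be checked by Hom-vanishing.\<close>

lemma componentI:
  assumes "i \<in> I" "X \<in> U" "\<And>j Y. j \<in> I \<Longrightarrow> j \<noteq> i \<Longrightarrow> Y \<in> component j \<Longrightarrow> Hom C X Y = {0}"
  shows "X \<in> component i"
proof -
  from components_decompose[OF assms(2)] obtain J P where J: "J \<subseteq> I" "is_direct_sum C J P X"
    "\<forall>j\<in>J. P j \<in> component j" by (elim exE conjE)
  have "\<exists>A\<in>component i. isomorphic C X A"
  proof (rule ex_isomorphic_component[OF J(2)])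
    show "P j \<in> component j" if "j \<in> J" for j using J(3) that by blast
    show "\<exists>Z\<in>component i. zero_object C Z" by (rule component_zero[OF assms(1)])
    show "Hom C X (P j) = {0}" if "j \<in> J" "j \<noteq> i" for j using assms(3) J(1,3) that by blast
  qed
  then show ?thesis
    using star_shifts_isomorphic[OF ct_direct_sumD(1)[OF D assms(1)]] isomorphic_sym by blast
qed

text \<open>A summand \<open>Z\<close> of \<open>Y\<close> in a component \<open>l \<noteq> j\<close> has \<open>Z[1]\<close> in \<open>T\<^sub>j\<close>, so that \<open>End(Z[1])\<close>, being dual to
  \<open>Hom(Z, Z[1][d - 1])\<close>, vanishes.\<close>

lemma desuspension_in_component:
  assumes j: "j \<in> I" and Y: "Shift C Y \<in> Ts j"
  shows "Y \<in> component j"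
proof -
  have "Shift C Y \<in> U" using Y ct_direct_sumD(2)[OF D j] cluster_tilting_inD(2)[OF T] by blast
  then have "Y \<in> U" using triangulated_subcategoryD(3)[OF U _ isomorphic_refl] by blast
  from components_decompose[OF this] obtain J P where J: "J \<subseteq> I" "is_direct_sum C J P Y"
    "\<forall>l\<in>J. P l \<in> component l" by (elim exE conjE)
  have zero: "zero_object C (P l)" if l: "l \<in> J" "l \<noteq> j" for l
  proof -
    have lI: "l \<in> I" and Pl: "P l \<in> component l" using J(1,3) l(1) by auto
    have SP: "Shift C (P l) \<in> Ts j"
      using subcategory_summand[OF ct_direct_sumD(1)[OF D j] Y is_direct_sum_Shift[OF J(2)] l(1)] .
    \<comment> \<open>The generators T_l[s] meet T_j[d-1] with difference d - 1 - s \<ge> 0, so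
      vanishing in nonnegative degrees is enough here.\<close>
    have "Hom C (Shift_n C 0 (P l)) (Shift_n C (d - 1) (Shift C (P l))) = {0}"
    proof (rule Hom_zero_star_shifts[where S' = "Ts j" and n = 0, OF Pl])
      show "Shift C (P l) \<in> star_shifts C (Ts j) 0" using SP by simp
      fix A B s t assume "A \<in> Ts l" "B \<in> Ts j" "s \<le> d - 1" "t \<le> (0::nat)"
      then show "Hom C (Shift_n C (0 + s) A) (Shift_n C (d - 1 + t) B) = {0}"
        using Hom_components_shifts[OF lI j l(2), of A B "d - 1" s] by simp
    qed
    then have "Hom C (Shift C (P l)) (Shift C (Shift_n C (d - 1) (Shift C (P l)))) = {0}"
      by (simp add: Hom_Shift_zero_iff)
    moreover have "Shift C (Shift_n C (d - 1) (Shift C (P l))) = Shift_n C d (Shift C (P l))"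
      using d Shift_n_add[of 1 "d - 1"] by simp
    ultimately have "Hom C (Shift C (P l)) (Shift C (P l)) = {0}"
      using calabi_yau_Hom_zero_iff[OF CY] by simp
    then show ?thesis by (simp add: Hom_Shift_zero_iff zero_object_iff_Hom)
  qed
  have "\<exists>A\<in>component j. isomorphic C Y A"
  proof (rule ex_isomorphic_component[OF J(2)])
    show "P l \<in> component l" if "l \<in> J" for l using J(3) that by blast
    show "\<exists>Z\<in>component j. zero_object C Z" by (rule component_zero[OF j])
    show "Hom C Y (P l) = {0}" if "l \<in> J" "l \<noteq> j" for l using Hom_zero_zero_object(1)[OF zero[OF that]] .
  qed
  then show ?thesis
    using star_shifts_isomorphic[OF ct_direct_sumD(1)[OF D j]] isomorphic_sym by blast
qed

text \<open>Only t = d - 1 and t = d are new. In the first case write Y as Y'[1] with Y' in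
  component j and apply Ext^1-orthogonality to X[d-1] and Y'. In the second, cancel one shift and
  filter Y' by T_j[r] with r from 0 to d - 1; the remaining shifts d - 1 - r are covered by the
  first case and conditions (2) and (3).\<close>

lemma Hom_components_neg:
  assumes ij: "i \<in> I" "j \<in> I" "i \<noteq> j" and XY: "X \<in> Ts i" "Y \<in> Ts j" and t: "t \<le> d"
  shows "Hom C (Shift_n C t X) Y = {0}"
proof -
  obtain Y' where Y': "isomorphic C (Shift C Y') Y" using Shift_ess_surj by blast
  have desuspend: "Z \<in> component j" if "B \<in> Ts j" "isomorphic C (Shift C Z) B" for Z B
    using desuspension_in_component[OF ij(2)]
      subcategory_isomorphic[OF ct_direct_sumD(1)[OF D ij(2)] that(1) isomorphic_sym[OF that(2)]] by blast
  have neg: "Hom C (Shift_n C s A) B = {0}" if s: "s \<le> d - 1" and A: "A \<in> Ts i" and B: "B \<in> Ts j" for s A B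
  proof (cases "s = d - 1")
    case True
    obtain B' where B': "isomorphic C (Shift C B') B" using Shift_ess_surj by blast
    have "Hom C (Shift_n C s A) (Shift C B') = {0}"
      using Ext1_components[OF ij Shift_n_in_star_shifts[OF ct_direct_sumD(1)[OF D ij(1)] A] desuspend[OF B B']]
        True by simp
    then show ?thesis using Hom_zero_isomorphic[OF _ isomorphic_refl B'] by blast
  next
    case False
    then show ?thesis using ct_direct_sumD(3)[OF D ij _ A B, of s] s by simp
  qed
  show ?thesis
  proof (cases "t = d")
    case True
    have "Hom C (Shift_n C (d - 1) X) (Shift_n C 0 Y') = {0}"
    proof (rule Hom_zero_star_shifts[where S = "Ts i" and m = 0])
      show "X \<in> star_shifts C (Ts i) 0" using XY(1) by simp
      show "Y' \<in> component j" by (rule desuspend[OF XY(2) Y'])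
      fix A B s r assume "A \<in> Ts i" "B \<in> Ts j" "s \<le> (0::nat)" "r \<le> d - 1"
      then show "Hom C (Shift_n C (d - 1 + s) A) (Shift_n C (0 + r) B) = {0}"
        using neg[of "d - 1 - r" A B] Hom_Shift_n_diff_left[of r "d - 1" A B] by simp
    qed
    then have "Hom C (Shift C (Shift_n C (d - 1) X)) (Shift C Y') = {0}" by (simp add: Hom_Shift_zero_iff)
    then have "Hom C (Shift_n C (Suc (d - 1)) X) Y = {0}"
      using Hom_zero_isomorphic[OF _ isomorphic_refl Y'] by simp
    then show ?thesis using True d by simp
  next
    case False then show ?thesis using neg[OF _ XY] t by simp
  qed
qed

text \<open>The differences of shifts run from -d to d - 1, within the reach of
  \<open>Hom_components_neg\<close> and \<open>Hom_components_nonneg\<close>. The case a = 1 is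
  there for closure under the shift.\<close>

lemma Hom_components:
  assumes ij: "i \<in> I" "j \<in> I" "i \<noteq> j" and XY: "X \<in> component i" "Y \<in> component j" and a: "a \<le> 1"
  shows "Hom C (Shift_n C a X) Y = {0}"
proof -
  have "Hom C (Shift_n C a X) (Shift_n C 0 Y) = {0}"
  proof (rule Hom_zero_star_shifts[OF XY])
    fix A B s t assume h: "A \<in> Ts i" "B \<in> Ts j" "s \<le> d - 1" "t \<le> d - 1"
    show "Hom C (Shift_n C (a + s) A) (Shift_n C (0 + t) B) = {0}"
    proof (cases "t \<le> a + s")
      case True
      then show ?thesis
        using Hom_components_neg[OF ij h(1,2), of "a + s - t"] Hom_Shift_n_diff_left[of t "a + s" A B] a d h(3)
        by simp
    next
      case False
      then show ?thesis
        using Hom_components_nonneg[OF ij h(1,2), of "t - (a + s)"] Hom_Shift_n_diff_right[of "a + s" t A B] h(4)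
        by simp
    qed
  qed
  then show ?thesis by simp
qed

text \<open>By \<open>componentI\<close> each closure property reduces to the absence of maps to the
  other components, a condition inherited by extensions and retracts.\<close>

lemma triangulated_subcategory_component:
  assumes i: "i \<in> I"
  shows "triangulated_subcategory C (component i)"
proof -
  note US = triangulated_subcategoryD(1)[OF U]
  have CU: "X \<in> U" if "X \<in> component i" for X using component_subset[OF i] that by (rule subsetD)
  have Hom0: "Hom C X Y = {0}" if "X \<in> component i" "j \<in> I" "j \<noteq> i" "Y \<in> component j" for X Y j
    using Hom_components[OF i that(2) that(3)[symmetric] that(1,4), of 0] by simp
  have retract: "A \<in> component i"
    if X: "X \<in> component i" and r: "f \<in> Hom C A X" "p \<in> Hom C X A" "p \<cdot> f = Idn C A" for A X f p
  proof (rule componentI[OF i])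
    show "A \<in> U" using subcategory_retract[OF US CU[OF X] r] .
    show "Hom C A Y = {0}" if "j \<in> I" "j \<noteq> i" "Y \<in> component j" for j Y
      using Hom_zero_retract[OF Hom0[OF X that] r] .
  qed
  have ext: "Z \<in> component i"
    if T: "Triangle C X Z Y f g h" and X: "X \<in> component i" and Y: "Y \<in> component i" for X Y Z f g h
  proof (rule componentI[OF i])
    show "Z \<in> U" using triangulated_subcategoryD(4)[OF U T CU[OF X] CU[OF Y]] .
    show "Hom C Z W = {0}" if "j \<in> I" "j \<noteq> i" "W \<in> component j" for j W
      using Hom_zero_triangle_left[OF T Hom0[OF X that] Hom0[OF Y that]] .
  qed
  have zero_obj: "Z \<in> component i" if Z: "zero_object C Z" for Z
  proof (rule componentI[OF i])
    show "Z \<in> U" using subcategory_zero_object[OF US Z] .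
    show "Hom C Z W = {0}" for W using Hom_zero_zero_object(2)[OF Z] .
  qed
  have iso: "Y \<in> component i" if "X \<in> component i" "isomorphic C X Y" for X Y
    using star_shifts_isomorphic[OF ct_direct_sumD(1)[OF D i] that] .
  have "subcategory C (component i)" unfolding subcategory_def
  proof (intro conjI allI impI)
    show "Y \<in> component i" if "X \<in> component i" "isomorphic C X Y" for X Y using iso[OF that] .
    show "Z \<in> component i" if "zero_object C Z" for Z using zero_obj[OF that] .
    show "X \<in> component i" if AB: "A \<in> component i" "B \<in> component i" "is_biproduct C A B X" for A B X
      using AB(3) unfolding is_biproduct_def
    proof (induction rule: is_direct_sum_induct)
      case (zero Z) then show ?case by (rule zero_obj)
    next
      case (extension X Y Z f g h) then show ?case using ext by blast
    next
      case (summand b) then show ?case using AB(1,2) by simp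
    qed
    fix A B X assume X: "X \<in> component i" "is_biproduct C A B X"
    from is_biproductE[OF X(2)] obtain f p s c where r: "f \<in> Hom C A X" "p \<in> Hom C X A" "s \<in> Hom C B X"
      "c \<in> Hom C X B" "p \<cdot> f = Idn C A" "c \<cdot> s = Idn C B" .
    show "A \<in> component i" using retract[OF X(1) r(1,2,5)] .
    show "B \<in> component i" using retract[OF X(1) r(3,4,6)] .
  qed
  moreover have "Shift C X \<in> component i" if X: "X \<in> component i" for X
  proof (rule componentI[OF i])
    show "Shift C X \<in> U" using triangulated_subcategoryD(2)[OF U CU[OF X]] .
    show "Hom C (Shift C X) Y = {0}" if "j \<in> I" "j \<noteq> i" "Y \<in> component j" for j Y
      using Hom_components[OF i that(1) that(2)[symmetric] X that(3), of 1] by simp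
  qed
  \<comment> \<open>For closure under [-1], Hom(X, W) is compared with Hom(X[1], W[1]), where
    Ext^1-orthogonality applies.\<close>
  moreover have "X \<in> component i" if Y: "Y \<in> component i" "isomorphic C (Shift C X) Y" for X Y
  proof (rule componentI[OF i])
    have SX: "Shift C X \<in> component i" using iso[OF Y(1) isomorphic_sym[OF Y(2)]] .
    show "X \<in> U" using triangulated_subcategory_unshift[OF U, of 1] CU[OF SX] by simp
    show "Hom C X W = {0}" if "j \<in> I" "j \<noteq> i" "W \<in> component j" for j W
      using Ext1_components[OF i that(1) that(2)[symmetric] SX that(3)] by (simp add: Hom_Shift_zero_iff)
  qed
  moreover have "star C (component i) (component i) \<subseteq> component i"
  proof
    fix Z assume "Z \<in> star C (component i) (component i)"
    then show "Z \<in> component i" unfolding star_def using ext by blast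
  qed
  ultimately show ?thesis unfolding triangulated_subcategory_def by simp
qed

lemma tri_direct_sum_of_ct_direct_sum: "tri_direct_sum C U I component"
  unfolding tri_direct_sum_def
proof (intro conjI ballI impI)
  show "triangulated_subcategory C (component i)" "component i \<subseteq> U" if "i \<in> I" for i
    by (rule triangulated_subcategory_component[OF that], rule component_subset[OF that])
  show "Hom C X Y = {0}" if "i \<in> I" "j \<in> I" "i \<noteq> j" "X \<in> component i" "Y \<in> component j" for i j X Y
    using Hom_components[OF that, of 0] by simp
  show "sums_of_components C U I component" unfolding sums_of_components_def
  proof
    fix X assume "X \<in> U"
    from components_decompose[OF this]
    obtain J P where "J \<subseteq> I" "is_direct_sum C J P X" "\<forall>j\<in>J. P j \<in> component j" by (elim exE conjE)
    then show "\<exists>J P. J \<subseteq> I \<and> (\<forall>j\<in>J. P j \<in> component j) \<and> is_direct_sum C J P X"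
      by (intro exI[of _ J] exI[of _ P]) simp
  qed
qed

text \<open>Summands in another \<open>Ts j\<close> receive no maps from component i, so only the
  summand in \<open>Ts i\<close> remains. Passing from \<open>T\<close> to \<open>U\<close> and
  intersecting back thus returns the given decomposition.\<close>

lemma ct_component_eq:
  assumes i: "i \<in> I"
  shows "T \<inter> component i = Ts i"
proof
  show "Ts i \<subseteq> T \<inter> component i"
    using ct_direct_sumD(2)[OF D i] subset_star_shifts[OF ct_direct_sumD(1)[OF D i]] by blast
  show "T \<inter> component i \<subseteq> Ts i"
  proof
    fix X assume X: "X \<in> T \<inter> component i"
    then have "X \<in> T" by blast
    from bspec[OF ct_direct_sumD(4)[OF D, unfolded sums_of_components_def] this]
    obtain J M where J: "J \<subseteq> I" "\<forall>j\<in>J. M j \<in> Ts j" "is_direct_sum C J M X" by (elim exE conjE)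
    have "\<exists>A\<in>Ts i. isomorphic C X A"
    proof (rule ex_isomorphic_component[OF J(3)])
      show "M j \<in> Ts j" if "j \<in> J" for j using J(2) that by blast
      show "\<exists>Z\<in>Ts i. zero_object C Z" using subcategory_zero[OF ct_direct_sumD(1)[OF D i]] .
      fix j assume j: "j \<in> J" "j \<noteq> i"
      then have jI: "j \<in> I" using J(1) by blast
      have "M j \<in> component j"
        using J(2) j(1) subset_star_shifts[OF ct_direct_sumD(1)[OF D jI]] by blast
      then show "Hom C X (M j) = {0}" 
        using Hom_components[OF i jI j(2)[symmetric], of X "M j" 0] X by simp
    qed
    then show "X \<in> Ts i"
      using subcategory_isomorphic[OF ct_direct_sumD(1)[OF D i]] isomorphic_sym by blast
  qed
qed
end

section \<open>Corresponding decompositions\<close>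

context triangulated_category
begin

text \<open>A splitting of \<open>T\<close> generates one of \<open>U\<close>, whose parts are
  nonzero because they contain those of \<open>T\<close>.\<close>

lemma tri_indecomposable_imp_ct_indecomposable:
  assumes "d > 1" "calabi_yau C d" "triangulated_subcategory C U" "cluster_tilting_in C d U T"
    and ind: "tri_indecomposable C U"
  shows "ct_indecomposable C d T"
  unfolding ct_indecomposable_def
proof (rule notI, elim exE conjE)
  fix F :: "bool \<Rightarrow> 'o set"
  assume F: "ct_direct_sum C d T UNIV F" and nz: "\<forall>b. nonzero_subcategory C (F b)"
  interpret decomposed_cluster_tilting C d U T UNIV F by unfold_locales fact+
  have "nonzero_subcategory C (component b)" for b
    using nz subset_star_shifts[OF ct_direct_sumD(1)[OF F], of b] unfolding nonzero_subcategory_def by blast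
  then have "\<forall>b. nonzero_subcategory C (component b)" ..
  then show False using ind tri_direct_sum_of_ct_direct_sum unfolding tri_indecomposable_def
    by (elim notE, intro exI[of _ component] conjI)
qed

text \<open>Intersecting with \<open>T\<close> cannot lose a part of a splitting: each
  \<open>F b\<close> is built from \<open>T \<inter> F b\<close> by shifts and extensions.\<close>

lemma ct_indecomposable_imp_tri_indecomposable:
  assumes U: "triangulated_subcategory C U" and T: "cluster_tilting_in C d U T"
    and ind: "ct_indecomposable C d T"
  shows "tri_indecomposable C U"
  unfolding tri_indecomposable_def
proof (rule notI, elim exE conjE)
  fix F :: "bool \<Rightarrow> 'o set"
  assume F: "tri_direct_sum C U UNIV F" and nz: "\<forall>b. nonzero_subcategory C (F b)"
  have "nonzero_subcategory C (T \<inter> F b)" for b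
  proof (rule ccontr)
    assume z: "\<not> nonzero_subcategory C (T \<inter> F b)"
    have "zero_object C X" if "X \<in> F b" for X
    proof (rule star_shifts_zero_object[of X "T \<inter> F b" "d - 1"])
      show "X \<in> star_shifts C (T \<inter> F b) (d - 1)"
        using cluster_tilting_eq_star_shifts[OF tri_direct_sumD(1)[OF F] cluster_tilting_in_component[OF T F]]
          that by simp
      show "zero_object C A" if "A \<in> T \<inter> F b" for A
        using z that unfolding nonzero_subcategory_def by blast
    qed
    then show False using nz unfolding nonzero_subcategory_def by blast
  qed
  then have "\<forall>b. nonzero_subcategory C (T \<inter> F b)" ..
  then show False using ind ct_direct_sum_of_tri_direct_sum[OF T F] unfolding ct_indecomposable_def
    by (elim notE, intro exI[of _ "\<lambda>b. T \<inter> F b"] conjI)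
qed

lemma ct_decomposition_of_tri_decomposition:
  assumes "d > 1" "calabi_yau C d" and T: "cluster_tilting_in C d UNIV T" and Cs: "tri_decomposition C I Cs"
  shows "ct_decomposition C d T I (\<lambda>i. T \<inter> Cs i)"
    "i \<in> I \<Longrightarrow> Cs i = star_shifts C (T \<inter> Cs i) (d - 1)"
    "i \<in> I \<Longrightarrow> cluster_tilting_in C d (Cs i) (T \<inter> Cs i)"
proof -
  have D: "tri_direct_sum C UNIV I Cs" and ind: "\<forall>i\<in>I. tri_indecomposable C (Cs i)"
    using Cs unfolding tri_decomposition_def by auto
  note ct = cluster_tilting_in_component[OF T D]
  show "i \<in> I \<Longrightarrow> cluster_tilting_in C d (Cs i) (T \<inter> Cs i)" by (rule ct)
  show "i \<in> I \<Longrightarrow> Cs i = star_shifts C (T \<inter> Cs i) (d - 1)"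
    by (rule cluster_tilting_eq_star_shifts[OF tri_direct_sumD(1)[OF D] ct])
  show "ct_decomposition C d T I (\<lambda>i. T \<inter> Cs i)" unfolding ct_decomposition_def
  proof (intro conjI ballI)
    show "ct_direct_sum C d T I (\<lambda>i. T \<inter> Cs i)" by (rule ct_direct_sum_of_tri_direct_sum[OF T D])
    show "ct_indecomposable C d (T \<inter> Cs i)" if "i \<in> I" for i
      using tri_indecomposable_imp_ct_indecomposable[OF assms(1,2) tri_direct_sumD(1)[OF D that] ct[OF that]]
        ind that by blast
  qed
qed

text \<open>Since \<open>ct_component_eq\<close> identifies \<open>T \<inter> component i\<close>
  with \<open>Ts i\<close>, the results on components of a triangulated decomposition apply to
  \<open>Ts i\<close> itself.\<close>

lemma tri_decomposition_of_ct_decomposition: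
  assumes "d > 1" "calabi_yau C d" and T: "cluster_tilting_in C d UNIV T" and Ts: "ct_decomposition C d T I Ts"
  shows "tri_decomposition C I (\<lambda>i. star_shifts C (Ts i) (d - 1))"
    "i \<in> I \<Longrightarrow> cluster_tilting_in C d (star_shifts C (Ts i) (d - 1)) (Ts i)"
proof -
  have D: "ct_direct_sum C d T I Ts" and ind: "\<forall>i\<in>I. ct_indecomposable C d (Ts i)"
    using Ts unfolding ct_decomposition_def by auto
  interpret decomposed_cluster_tilting C d UNIV T I Ts
    by unfold_locales (fact triangulated_subcategory_UNIV assms D)+
  have ct: "cluster_tilting_in C d (component i) (Ts i)" if "i \<in> I" for i
    using cluster_tilting_in_component[OF T tri_direct_sum_of_ct_direct_sum that] ct_component_eq[OF that] by simp
  show "i \<in> I \<Longrightarrow> cluster_tilting_in C d (component i) (Ts i)" by (rule ct)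
  show "tri_decomposition C I component" unfolding tri_decomposition_def
  proof (intro conjI ballI)
    show "tri_direct_sum C UNIV I component" by (rule tri_direct_sum_of_ct_direct_sum)
    show "tri_indecomposable C (component i)" if "i \<in> I" for i
      using ct_indecomposable_imp_tri_indecomposable[OF triangulated_subcategory_component[OF that] ct[OF that]]
        ind that by blast
  qed
qed

end

theorem theorem3p10:
  fixes C :: "('o, 'm::ab_group_add, 'k::field) tri_cat"
    and d :: nat and T :: "'o set" and I :: "'i set"
  assumes "d > 1"
    and "triangulated_category C" and "hom_finite C" and "krull_schmidt C"
    and "calabi_yau C d"
    and "cluster_tilting_in C d UNIV T"
  shows "((\<exists>Cs. tri_decomposition C I Cs) \<longleftrightarrow> (\<exists>Ts. ct_decomposition C d T I Ts)) \<and>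
    (\<forall>Cs. tri_decomposition C I Cs \<longrightarrow>
       (\<exists>Ts. ct_decomposition C d T I Ts \<and>
          (\<forall>i\<in>I. Cs i = star_shifts C (Ts i) (d - 1) \<and> cluster_tilting_in C d (Cs i) (Ts i)))) \<and>
    (\<forall>Ts. ct_decomposition C d T I Ts \<longrightarrow>
       (\<exists>Cs. tri_decomposition C I Cs \<and>
          (\<forall>i\<in>I. Cs i = star_shifts C (Ts i) (d - 1) \<and> cluster_tilting_in C d (Cs i) (Ts i))))"
proof -
  interpret triangulated_category C by fact
  note tc = ct_decomposition_of_tri_decomposition[OF assms(1,5,6)]
    and ct = tri_decomposition_of_ct_decomposition[OF assms(1,5,6)]
  show ?thesis
  proof (intro conjI allI impI iffI)
    show "\<exists>Ts. ct_decomposition C d T I Ts" if "\<exists>Cs. tri_decomposition C I Cs"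
      using that by (rule exE) (rule exI, rule tc(1))
    show "\<exists>Cs. tri_decomposition C I Cs" if "\<exists>Ts. ct_decomposition C d T I Ts"
      using that by (rule exE) (rule exI, rule ct(1))
  next
    fix Cs assume D: "tri_decomposition C I Cs"
    show "\<exists>Ts. ct_decomposition C d T I Ts \<and>
      (\<forall>i\<in>I. Cs i = star_shifts C (Ts i) (d - 1) \<and> cluster_tilting_in C d (Cs i) (Ts i))"
    proof (rule exI[of _ "\<lambda>i. T \<inter> Cs i"], intro conjI ballI)
      show "ct_decomposition C d T I (\<lambda>i. T \<inter> Cs i)" by (rule tc(1)[OF D])
      fix i assume i: "i \<in> I"
      show "Cs i = star_shifts C (T \<inter> Cs i) (d - 1)" by (rule tc(2)[OF D i])
      show "cluster_tilting_in C d (Cs i) (T \<inter> Cs i)" by (rule tc(3)[OF D i])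
    qed
  next
    fix Ts assume D: "ct_decomposition C d T I Ts"
    show "\<exists>Cs. tri_decomposition C I Cs \<and>
      (\<forall>i\<in>I. Cs i = star_shifts C (Ts i) (d - 1) \<and> cluster_tilting_in C d (Cs i) (Ts i))"
    proof (rule exI[of _ "\<lambda>i. star_shifts C (Ts i) (d - 1)"], intro conjI ballI)
      show "tri_decomposition C I (\<lambda>i. star_shifts C (Ts i) (d - 1))" by (rule ct(1)[OF D])
      fix i assume i: "i \<in> I"
      show "star_shifts C (Ts i) (d - 1) = star_shifts C (Ts i) (d - 1)" ..
      show "cluster_tilting_in C d (star_shifts C (Ts i) (d - 1)) (Ts i)" by (rule ct(2)[OF D i])
    qed
  qed
qed

end
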